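(* Let $\mathbb{F}\in\{\mathbb{R},\mathbb{C}\}$ and let $d\ge 1$ and $k\geq 3$ be fixed integers. There is an integer-valued function $m(n)$ with $m(n)= n\log n+dn\log\log n+o(n\log\log n)$ as $n\to\infty$ such that the following holds. For each $n$ let $T=T_n\in\mathbb{F}^{n\times n\times\dots\times n}$ be any generic tensor of order $k$ and rank $d$. If a set of $m(n)$ entries (index positions) of $T$ is chosen uniformly at random among all sets of $m(n)$ positions, then the probability that the observed entries uniquely determine $T$ tends to $1$ as $n\to\infty$.
   Context: The (CP) rank of an order $k$ tensor $T\in\mathbb{F}^{n\times\dots\times n}$ is the smallest $d$ such that $T=\sum_{i=1}^d x_i^1\otimes x_i^2\otimes\dots\otimes x_i^k$ for some vectors $x_i^j\in\mathbb{F}^n$. A tensor $T$ of rank $d$ is generic if it admits such a decomposition (with $d$ terms) in which the entries of all the vectors $x_i^j$ ($1\le i\le d$, $1\le j\le k$) together are algebraically independent over $\mathbb{Q}$. The observed entries uniquely determine $T$ if $T$ is the only tensor in $\mathbb{F}^{n\times\dots\times n}$ of rank at most $d$ whose entries at the observed positions agree with those of $T$. $\log$ is the natural logarithm. *)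

theory Defs
  imports "HOL-Probability.Probability" "HOL-Library.Poly_Mapping" "HOL-Library.Landau_Symbols"
begin

text \<open>A position \<open>(p 0, \<dots>, p (k - 1))\<close> of an order \<open>k\<close> tensor with all dimensions \<open>n\<close>; indices are
  counted from \<open>0\<close>.\<close>

definition positions :: "nat \<Rightarrow> nat \<Rightarrow> (nat \<Rightarrow> nat) set"
  where "positions k n = {..<k} \<rightarrow>\<^sub>E {..<n}"

text \<open>Tensors are extensional (\<^const>\<open>undefined\<close> off the positions), so that equality of functions is
  equality of tensors.\<close>

definition tensors :: "nat \<Rightarrow> nat \<Rightarrow> ((nat \<Rightarrow> nat) \<Rightarrow> 'a) set"
  where "tensors k n = positions k n \<rightarrow>\<^sub>E UNIV"

text \<open>The sum of \<open>r\<close> rank-one tensors \<open>x i 0 \<otimes> \<dots> \<otimes> x i (k - 1)\<close>. Here \<open>x i j l\<close> is the \<open>l\<close>-th entry of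
  the vector \<open>x i j\<close>; only the entries with \<open>l < n\<close> are used.\<close>

definition cp_tensor ::
    "nat \<Rightarrow> nat \<Rightarrow> nat \<Rightarrow> (nat \<Rightarrow> nat \<Rightarrow> nat \<Rightarrow> 'a::field_char_0) \<Rightarrow> (nat \<Rightarrow> nat) \<Rightarrow> 'a"
  where "cp_tensor k n r x = (\<lambda>p\<in>positions k n. \<Sum>i<r. \<Prod>j<k. x i j (p j))"

definition cp_rank :: "nat \<Rightarrow> nat \<Rightarrow> ((nat \<Rightarrow> nat) \<Rightarrow> 'a::field_char_0) \<Rightarrow> nat"
  where "cp_rank k n T = (LEAST r. \<exists>x. T = cp_tensor k n r x)"

text \<open>Multivariate polynomials over \<open>\<rat>\<close> with variables in \<open>'v\<close> are finitely supported maps from monomials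
  to coefficients, where a monomial is the finitely supported map \<open>'v \<Rightarrow>\<^sub>0 nat\<close> of its exponents.\<close>

definition eval_rat_poly :: "(('v \<Rightarrow>\<^sub>0 nat) \<Rightarrow>\<^sub>0 rat) \<Rightarrow> ('v \<Rightarrow> 'a::field_char_0) \<Rightarrow> 'a"
  where "eval_rat_poly P a =
    (\<Sum>m\<in>Poly_Mapping.keys P. of_rat (Poly_Mapping.lookup P m) *
      (\<Prod>v\<in>Poly_Mapping.keys m. a v ^ Poly_Mapping.lookup m v))"

text \<open>Independence of the family \<open>(a v)\<close>, \<open>v \<in> I\<close>, rather than of its set of values: in particular the
  family has no repetitions.\<close>

definition alg_independent_rat :: "'v set \<Rightarrow> ('v \<Rightarrow> 'a::field_char_0) \<Rightarrow> bool"
  where "alg_independent_rat I a \<longleftrightarrow>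
    (\<forall>P. (\<forall>m\<in>Poly_Mapping.keys P. Poly_Mapping.keys m \<subseteq> I) \<longrightarrow> eval_rat_poly P a = 0 \<longrightarrow> P = 0)"

definition generic_tensor :: "nat \<Rightarrow> nat \<Rightarrow> nat \<Rightarrow> ((nat \<Rightarrow> nat) \<Rightarrow> 'a::field_char_0) \<Rightarrow> bool"
  where "generic_tensor k n d T \<longleftrightarrow>
    T \<in> tensors k n \<and> cp_rank k n T = d \<and>
    (\<exists>x. T = cp_tensor k n d x \<and>
      alg_independent_rat ({..<d} \<times> {..<k} \<times> {..<n}) (\<lambda>(i, j, l). x i j l))"

definition uniquely_determines ::
    "nat \<Rightarrow> nat \<Rightarrow> nat \<Rightarrow> ((nat \<Rightarrow> nat) \<Rightarrow> 'a::field_char_0) \<Rightarrow> (nat \<Rightarrow> nat) set \<Rightarrow> bool"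
  where "uniquely_determines k n d T \<Omega> \<longleftrightarrow>
    (\<forall>S\<in>tensors k n. cp_rank k n S \<le> d \<longrightarrow> (\<forall>p\<in>\<Omega>. S p = T p) \<longrightarrow> S = T)"

text \<open>The uniform distribution on the sets of \<open>m\<close> positions; it is meaningful only if \<open>m \<le> n ^ k\<close>, as
  otherwise there are no such sets.\<close>

definition random_positions :: "nat \<Rightarrow> nat \<Rightarrow> nat \<Rightarrow> (nat \<Rightarrow> nat) set pmf"
  where "random_positions k n m = pmf_of_set {\<Omega>. \<Omega> \<subseteq> positions k n \<and> card \<Omega> = m}"

end

theory Submission
  imports Defs "Jordan_Normal_Form.Determinant" "HOL-Library.Function_Algebras"
    "HOL-Real_Asymp.Real_Asymp"
begin

text \<open>
  Write \<open>T = cp_tensor k n d x\<close> with generic \<open>x\<close>, let \<open>\<Omega>\<close> be the observed positions, and let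
  \<open>S = cp_tensor k n d y\<close> be any tensor of rank at most \<open>d\<close> that agrees with \<open>T\<close> on \<open>\<Omega>\<close>. The proof
  that \<open>S = T\<close> combines a counting argument, which gives agreement on a positive proportion of all
  positions, with an algebraic growth argument, which spreads the agreement to all of them.

  Counting. The set where \<open>S\<close> and \<open>T\<close> agree is the zero pattern of \<open>n ^ k\<close> polynomials in the
  \<open>d * k * n\<close> entries of \<open>y\<close>. By the theorem of Ronyai, Babai and Ganapathy
  (\<open>zero_pattern_bound\<close>) only \<open>exp (O (n ln n))\<close> sets occur in this way, whatever \<open>y\<close> is. A fixed set of
  density less than \<open>\<epsilon>\<close> contains all of \<open>\<Omega>\<close> with probability at most \<open>2 * \<epsilon> ^ m\<close>, and \<open>m \<ge> n ln n\<close>.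
  So for a small constant \<open>\<epsilon>\<close> a union bound shows that with high probability every such \<open>S\<close> agrees with
  \<open>T\<close> on at least \<open>\<epsilon> * n ^ k\<close> positions (\<open>prob_sparse_agreement_le\<close>).

  Growth. Call a pair of a coordinate and an index a vertex; a set of vertices spans a box of
  positions. If \<open>S = T\<close> on a box with at least \<open>d\<close> vertices in each coordinate, and if a further vertex
  lies on \<open>d\<close> positions of agreement whose other vertices belong to the box, then \<open>S = T\<close> on the box
  enlarged by that vertex (\<open>box_grow\<close>): each new entry completes a \<open>(d + 1) \<times> (d + 1)\<close> minor of a
  flattening, which vanishes for \<open>S\<close> and for \<open>T\<close>, and the complementary \<open>d \<times> d\<close> minor of \<open>T\<close> is nonzero
  because \<open>x\<close> is generic.

  A seed for the growth is found in the dense set of agreement: it contains a box with \<open>d\<close> vertices in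
  each coordinate to which linearly many vertices in each coordinate can be added
  (\<open>dense_contains_boxes\<close>). From there \<open>\<Omega>\<close> takes over: with high probability every proper set of
  vertices with linearly many vertices in each coordinate misses some vertex that lies on \<open>d\<close> observed
  positions with all other vertices in the set (\<open>prob_not_expanding_tendsto_0\<close>). This step is the one
  that fixes the number of samples. A vertex lies on about \<open>ln n + d ln (ln n)\<close> observed positions, so
  it lies on fewer than \<open>d\<close> of them with probability about \<open>1 / (n ln n)\<close>, and there are only \<open>k * n\<close>
  vertices; sets with many missing vertices are even less likely to be stuck.
\<close>

section \<open>Bordered minors\<close>

text \<open>Square arrays are functions on indices, which spares the carrier conditions of \<^typ>\<open>'a mat\<close>;
  only the entries below \<open>d\<close> matter.\<close>

definition nonsing :: "nat \<Rightarrow> (nat \<Rightarrow> nat \<Rightarrow> 'a::field) \<Rightarrow> bool"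
  where "nonsing d M \<longleftrightarrow> Determinant.det (Matrix.mat d d (\<lambda>(a, b). M a b)) \<noteq> 0"

lemma nonsing_kernel:
  fixes M :: "nat \<Rightarrow> nat \<Rightarrow> 'a::field"
  assumes "nonsing d M" and "\<And>a. a < d \<Longrightarrow> (\<Sum>b<d. M a b * z b) = 0" and "b < d"
  shows "z b = 0"
proof (rule ccontr)
  assume "z b \<noteq> 0"
  let ?A = "Matrix.mat d d (\<lambda>(a, b). M a b)"
  let ?v = "Matrix.vec d z"
  have "?v \<noteq> 0\<^sub>v d" using \<open>z b \<noteq> 0\<close> \<open>b < d\<close> by (metis index_vec index_zero_vec(1))
  moreover have "?A *\<^sub>v ?v = 0\<^sub>v d"
    using assms(2) by (intro eq_vecI) (auto simp: scalar_prod_def lessThan_atLeast0)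
  ultimately have "Determinant.det ?A = 0"
    using det_0_iff_vec_prod_zero[of ?A d] by (metis mat_carrier vec_carrier)
  then show False using assms(1) by (simp add: nonsing_def)
qed

lemma nonsing_transpose: "nonsing d (\<lambda>a b. M b a) \<longleftrightarrow> nonsing d M"
proof -
  have "Matrix.mat d d (\<lambda>(a, b). M b a) = transpose_mat (Matrix.mat d d (\<lambda>(a, b). M a b))"
    by (intro eq_matI) auto
  then show ?thesis by (simp add: nonsing_def det_transpose[where n=d])
qed

lemma nonsing_mult:
  assumes "\<And>a b. a < d \<Longrightarrow> b < d \<Longrightarrow> M a b = (\<Sum>i<d. U a i * V b i)"
  shows "nonsing d M \<longleftrightarrow> nonsing d U \<and> nonsing d V"
proof -
  let ?U = "Matrix.mat d d (\<lambda>(a, b). U a b)" and ?V = "Matrix.mat d d (\<lambda>(a, b). V b a)"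
  have "Matrix.mat d d (\<lambda>(a, b). M a b) = ?U * ?V"
    using assms by (intro eq_matI) (auto simp: scalar_prod_def lessThan_atLeast0)
  then have "nonsing d M \<longleftrightarrow> nonsing d U \<and> nonsing d (\<lambda>a b. V b a)"
    by (simp add: nonsing_def det_mult[where n=d])
  then show ?thesis using nonsing_transpose[of d V] by simp
qed

lemma nonsing_solve:
  fixes M :: "nat \<Rightarrow> nat \<Rightarrow> 'a::field"
  assumes "nonsing d M"
  obtains c where "\<And>i. i < d \<Longrightarrow> (\<Sum>a<d. c a * M a i) = r i"
proof -
  let ?A = "Matrix.mat d d (\<lambda>(a, b). M b a)"
  have "Determinant.det ?A \<noteq> 0" using assms nonsing_transpose[of d M] by (simp add: nonsing_def)
  then obtain B where B: "B \<in> carrier_mat d d" "?A * B = 1\<^sub>m d"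
    using det_non_zero_imp_unit[of ?A d, unfolded Units_def, of "()"]
    by (auto simp: ring_mat_simps)
  define w where "w = B *\<^sub>v Matrix.vec d r"
  have w: "w \<in> carrier_vec d" unfolding w_def by (rule mult_mat_vec_carrier[OF B(1)]) simp
  have "?A *\<^sub>v w = (?A * B) *\<^sub>v Matrix.vec d r"
    unfolding w_def by (rule assoc_mult_mat_vec[symmetric, OF _ B(1)]) auto
  then have *: "?A *\<^sub>v w = Matrix.vec d r" using B by simp
  have "(\<Sum>a<d. vec_index w a * M a i) = r i" if "i < d" for i
  proof -
    have "vec_index (?A *\<^sub>v w) i = r i" using that unfolding * by simp
    then show ?thesis using that w by (simp add: scalar_prod_def lessThan_atLeast0 mult.commute)
  qed
  then show ?thesis by (rule that)
qed

text \<open>The entry completing a bordered nonsingular minor is determined by rank. The last row of \<open>u\<close>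
  is a combination of its other rows; the nonsingular minor forces the last row of \<open>u'\<close> to be the
  same combination, because \<open>v'\<close> is nonsingular too: its product with \<open>u'\<close> is the common minor.\<close>

lemma bordered_entry:
  fixes u v u' v' :: "nat \<Rightarrow> nat \<Rightarrow> 'a::field"
  assumes agree: "\<And>a b. a \<le> d \<Longrightarrow> b \<le> d \<Longrightarrow> (a, b) \<noteq> (d, d) \<Longrightarrow>
      (\<Sum>i<d. u a i * v b i) = (\<Sum>i<d. u' a i * v' b i)"
    and u: "nonsing d u" and v: "nonsing d v"
  shows "(\<Sum>i<d. u d i * v d i) = (\<Sum>i<d. u' d i * v' d i)"
proof -
  have "nonsing d (\<lambda>a b. \<Sum>i<d. u a i * v b i)"
    using nonsing_mult[of d "\<lambda>a b. \<Sum>i<d. u a i * v b i" u v] u v by simp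
  then have v': "nonsing d v'"
    using nonsing_mult[of d "\<lambda>a b. \<Sum>i<d. u a i * v b i" u' v'] agree by simp
  obtain c where c: "\<And>i. i < d \<Longrightarrow> (\<Sum>a<d. c a * u a i) = u d i"
    using nonsing_solve[OF u, of "u d"] by blast
  have swap: "(\<Sum>a<d. c a * (\<Sum>i<d. g a i * h i)) = (\<Sum>i<d. (\<Sum>a<d. c a * g a i) * h i)"
    for g :: "nat \<Rightarrow> nat \<Rightarrow> 'a" and h
    by (simp add: sum_distrib_left sum_distrib_right mult.assoc) (rule sum.swap)
  have row: "(\<Sum>i<d. u d i * v b i) = (\<Sum>a<d. c a * (\<Sum>i<d. u a i * v b i))" for b
    by (simp add: swap c)
  define z where "z i = u' d i - (\<Sum>a<d. c a * u' a i)" for i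
  have zb: "(\<Sum>i<d. z i * v' b i) = (\<Sum>i<d. u' d i * v' b i) - (\<Sum>a<d. c a * (\<Sum>i<d. u' a i * v' b i))" for b
    by (simp add: swap z_def left_diff_distrib sum_subtractf)
  have "(\<Sum>i<d. v' b i * z i) = 0" if "b < d" for b
  proof -
    have "(\<Sum>i<d. z i * v' b i) = (\<Sum>i<d. u d i * v b i) - (\<Sum>a<d. c a * (\<Sum>i<d. u a i * v b i))"
      unfolding zb using agree that by simp
    then show ?thesis by (simp add: row mult.commute)
  qed
  note ker = this
  have z0: "z i = 0" if "i < d" for i
    by (rule nonsing_kernel[OF v' _ that]) (use ker in simp)
  have "(\<Sum>i<d. u' d i * v' d i) = (\<Sum>a<d. c a * (\<Sum>i<d. u' a i * v' d i))"
  proof -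
    have 0: "(\<Sum>i<d. z i * v' d i) = 0" using z0 by (intro sum.neutral) simp
    show ?thesis by (rule eq_iff_diff_eq_0[THEN iffD2, OF trans[OF zb[of d, symmetric] 0]])
  qed
  also have "\<dots> = (\<Sum>a<d. c a * (\<Sum>i<d. u a i * v d i))"
    using agree by simp
  finally show ?thesis by (simp add: row)
qed

section \<open>Minors of generic matrices\<close>

definition eval_monom :: "('v \<Rightarrow>\<^sub>0 nat) \<Rightarrow> ('v \<Rightarrow> 'a::comm_semiring_1) \<Rightarrow> 'a"
  where "eval_monom m a = (\<Prod>v\<in>Poly_Mapping.keys m. a v ^ Poly_Mapping.lookup m v)"

lemma eval_monom_superset:
  assumes "finite V" "Poly_Mapping.keys m \<subseteq> V"
  shows "eval_monom m a = (\<Prod>v\<in>V. a v ^ Poly_Mapping.lookup m v)"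
  unfolding eval_monom_def using assms
  by (intro prod.mono_neutral_left) (auto simp: in_keys_iff)

lemma eval_monom_add: "eval_monom (m + m') a = eval_monom m a * eval_monom m' a"
proof -
  let ?V = "Poly_Mapping.keys m \<union> Poly_Mapping.keys m'"
  have "eval_monom (m + m') a = (\<Prod>v\<in>?V. a v ^ Poly_Mapping.lookup (m + m') v)"
    by (rule eval_monom_superset) (auto simp: in_keys_iff lookup_add)
  moreover have "eval_monom m a = (\<Prod>v\<in>?V. a v ^ Poly_Mapping.lookup m v)"
    by (rule eval_monom_superset) auto
  moreover have "eval_monom m' a = (\<Prod>v\<in>?V. a v ^ Poly_Mapping.lookup m' v)"
    by (rule eval_monom_superset) auto
  ultimately show ?thesis by (simp add: lookup_add power_add prod.distrib)
qed

lemma eval_monom_0: "eval_monom 0 a = 1"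
  by (simp add: eval_monom_def)

lemma eval_monom_single: "eval_monom (Poly_Mapping.single v 1) a = a v"
  by (simp add: eval_monom_def)

lemma eval_monom_sum: "eval_monom (\<Sum>s\<in>S. f s) a = (\<Prod>s\<in>S. eval_monom (f s) a)"
  by (induction S rule: infinite_finite_induct) (auto simp: eval_monom_0 eval_monom_add)

text \<open>Distinct monomials cannot cancel, so a sum of terms with distinct monomials has exactly these terms
  as coefficients.\<close>

lemma eval_rat_poly_sum_monoms:
  fixes a :: "'v \<Rightarrow> 'a::field_char_0" and c :: "'s \<Rightarrow> rat"
  assumes S: "finite S" and inj: "inj_on m S"
  defines "P \<equiv> (\<Sum>s\<in>S. Poly_Mapping.single (m s) (c s))"
  shows "eval_rat_poly P a = (\<Sum>s\<in>S. of_rat (c s) * eval_monom (m s) a)"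
    and "Poly_Mapping.keys P \<subseteq> m ` S"
    and "s \<in> S \<Longrightarrow> Poly_Mapping.lookup P (m s) = c s"
proof -
  show lookup: "Poly_Mapping.lookup P (m s) = c s" if "s \<in> S" for s
  proof -
    have "Poly_Mapping.lookup P (m s) = (\<Sum>t\<in>S. if t = s then c t else 0)"
      unfolding P_def lookup_sum
      by (intro sum.cong refl) (use inj that in \<open>auto simp: lookup_single when_def inj_on_def\<close>)
    then show ?thesis using S that by simp
  qed
  show keys: "Poly_Mapping.keys P \<subseteq> m ` S"
    unfolding P_def by (rule order_trans[OF keys_sum]) auto
  have "eval_rat_poly P a = (\<Sum>u\<in>m ` S. of_rat (Poly_Mapping.lookup P u) * eval_monom u a)"
    unfolding eval_rat_poly_def eval_monom_def using S keys
    by (intro sum.mono_neutral_left) (auto simp: in_keys_iff)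
  also have "\<dots> = (\<Sum>s\<in>S. of_rat (c s) * eval_monom (m s) a)"
    using lookup by (simp add: sum.reindex[OF inj])
  finally show "eval_rat_poly P a = (\<Sum>s\<in>S. of_rat (c s) * eval_monom (m s) a)" .
qed

text \<open>The determinant is a signed sum over permutations \<open>\<sigma>\<close> of the monomials
  \<open>\<Prod>a. \<Prod>j\<in>J. x (\<sigma> a) j (p a j)\<close>. The factors with first index \<open>i\<close> show the row \<open>p a\<close> with \<open>\<sigma> a = i\<close>, so
  different permutations give different monomials as the rows are distinct on \<open>J\<close>, and algebraic
  independence forbids the sum to vanish. The case of a single \<open>j\<close> is the matrix of one factor of the
  decomposition, and the complement of \<open>j\<close> is the matrix of the products of the other factors.\<close>

lemma generic_minor_nonsing:
  fixes x :: "nat \<Rightarrow> nat \<Rightarrow> nat \<Rightarrow> 'a::field_char_0"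
  assumes ind: "alg_independent_rat ({..<d} \<times> {..<k} \<times> {..<n}) (\<lambda>(i, j, l). x i j l)"
    and J: "J \<subseteq> {..<k}"
    and p: "\<And>a j. a < d \<Longrightarrow> j \<in> J \<Longrightarrow> p a j < n"
    and distinct: "\<And>a b. a < d \<Longrightarrow> b < d \<Longrightarrow> a \<noteq> b \<Longrightarrow> \<exists>j\<in>J. p a j \<noteq> p b j"
  shows "nonsing d (\<lambda>a i. \<Prod>j\<in>J. x i j (p a j))"
proof -
  let ?x = "\<lambda>(i, j, l). x i j l"
  define S where "S = {\<sigma>. \<sigma> permutes {0..<d}}"
  define mono where "mono \<sigma> = (\<Sum>a<d. \<Sum>j\<in>J. Poly_Mapping.single (\<sigma> a, j, p a j) (1::nat))"
    for \<sigma> :: "nat \<Rightarrow> nat"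
  have finJ: "finite J" using J finite_subset by blast
  have finS: "finite S" by (simp add: S_def finite_permutations)
  have lookup: "Poly_Mapping.lookup (mono \<sigma>) (i, j, l) =
      (\<Sum>a<d. if \<sigma> a = i \<and> j \<in> J \<and> p a j = l then 1 else 0)" for \<sigma> i j l
  proof -
    have "(\<Sum>j'\<in>J. Poly_Mapping.lookup (Poly_Mapping.single (\<sigma> a, j', p a j') (1::nat)) (i, j, l)) =
        (if \<sigma> a = i \<and> j \<in> J \<and> p a j = l then 1 else 0)" for a
    proof -
      have "(\<Sum>j'\<in>J. Poly_Mapping.lookup (Poly_Mapping.single (\<sigma> a, j', p a j') (1::nat)) (i, j, l)) =
        (\<Sum>j'\<in>J. if j' = j then if \<sigma> a = i \<and> p a j = l then 1 else 0 else 0)"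
        by (intro sum.cong refl) (auto simp: lookup_single when_def)
      then show ?thesis using finJ by auto
    qed
    then show ?thesis by (simp add: mono_def lookup_sum)
  qed
  have inj: "inj_on mono S"
  proof (rule inj_onI, rule ccontr)
    fix \<sigma> \<tau> assume \<sigma>: "\<sigma> \<in> S" and \<tau>: "\<tau> \<in> S" and eq: "mono \<sigma> = mono \<tau>" and "\<sigma> \<noteq> \<tau>"
    then obtain a where a: "\<sigma> a \<noteq> \<tau> a" by auto
    then have "a < d" using \<sigma> \<tau> permutes_not_in[of \<sigma> "{0..<d}" a] permutes_not_in[of \<tau> "{0..<d}" a]
      unfolding S_def by (cases "a < d") auto
    note a = this a
    have "\<sigma> a < d" using \<sigma> a unfolding S_def
      by (metis atLeast0LessThan lessThan_iff mem_Collect_eq permutes_in_image)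
    then obtain b where b: "b < d" "\<tau> b = \<sigma> a" using \<tau> unfolding S_def
      by (metis (mono_tags, lifting) atLeast0LessThan lessThan_iff mem_Collect_eq permutes_image imageE)
    have inj\<tau>: "a' = b" if "\<tau> a' = \<sigma> a" for a'
      using permutes_inj[of \<tau> "{0..<d}"] \<tau> b that injD[of \<tau> a' b] unfolding S_def by simp
    obtain j where j: "j \<in> J" "p a j \<noteq> p b j" using distinct a b by metis
    have "Poly_Mapping.lookup (mono \<sigma>) (\<sigma> a, j, p a j) \<ge> (\<Sum>a'<d. if a' = a then 1 else 0)"
      unfolding lookup using j by (intro sum_mono) auto
    moreover have "Poly_Mapping.lookup (mono \<tau>) (\<sigma> a, j, p a j) = 0"
      unfolding lookup using j inj\<tau> by (intro sum.neutral) auto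
    ultimately show False using a eq by simp
  qed
  define P where "P = (\<Sum>\<sigma>\<in>S. Poly_Mapping.single (mono \<sigma>) (of_int (sign \<sigma>) :: rat))"
  note P = eval_rat_poly_sum_monoms[OF finS inj, where c = "\<lambda>\<sigma>. of_int (sign \<sigma>)", folded P_def]
  have val: "eval_monom (mono \<sigma>) ?x = (\<Prod>a<d. \<Prod>j\<in>J. x (\<sigma> a) j (p a j))" for \<sigma>
    by (simp add: mono_def eval_monom_sum eval_monom_single[unfolded One_nat_def])
  have "eval_rat_poly P ?x = Determinant.det (Matrix.mat d d (\<lambda>(a, i). \<Prod>j\<in>J. x i j (p a j)))"
  proof -
    have "Determinant.det (Matrix.mat d d (\<lambda>(a, i). \<Prod>j\<in>J. x i j (p a j)))
        = (\<Sum>\<sigma>\<in>S. of_int (sign \<sigma>) * (\<Prod>a=0..<d. \<Prod>j\<in>J. x (\<sigma> a) j (p a j)))"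
      unfolding S_def by (subst det_def'[of _ d]) (auto intro!: sum.cong prod.cong simp: permutes_in_image)
    then show ?thesis by (simp add: P(1) val lessThan_atLeast0)
  qed
  moreover have "eval_rat_poly P ?x \<noteq> 0"
  proof
    assume 0: "eval_rat_poly P ?x = 0"
    have "Poly_Mapping.keys m \<subseteq> {..<d} \<times> {..<k} \<times> {..<n}" if "m \<in> Poly_Mapping.keys P" for m
    proof -
      obtain \<sigma> where \<sigma>: "\<sigma> \<in> S" "m = mono \<sigma>" using P(2) \<open>m \<in> Poly_Mapping.keys P\<close> by auto
      have "v \<in> {..<d} \<times> {..<k} \<times> {..<n}" if "v \<in> Poly_Mapping.keys m" for v
      proof -
        obtain i j l where v: "v = (i, j, l)" by (cases v)
        have "(\<Sum>a<d. if \<sigma> a = i \<and> j \<in> J \<and> p a j = l then 1 else 0) \<noteq> (0::nat)"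
          using that unfolding v \<sigma> in_keys_iff lookup .
        then have "\<exists>a<d. \<sigma> a = i \<and> j \<in> J \<and> p a j = l"
          by (rule contrapos_np) (auto intro!: sum.neutral)
        then obtain a where "a < d" "\<sigma> a = i" "j \<in> J" "p a j = l" by blast
        then show ?thesis using v J p \<sigma>(1) permutes_in_image[of \<sigma> "{0..<d}" a] by (auto simp: S_def)
      qed
      then show ?thesis by blast
    qed
    then have "P = 0" using ind 0 unfolding alg_independent_rat_def by blast
    moreover have "id \<in> S" by (simp add: S_def permutes_id)
    ultimately show False using P(3)[of id] by (simp add: sign_id)
  qed
  ultimately show ?thesis by (simp add: nonsing_def)
qed

section \<open>Growing a box of agreement\<close>

abbreviation slice :: "(nat \<times> nat) set \<Rightarrow> nat \<Rightarrow> nat set"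
  where "slice B j \<equiv> B `` {j}"

text \<open>Boxes are given by sets of vertices, that is, of pairs of a coordinate and an index, because they
  grow by one vertex at a time.\<close>

definition box :: "nat \<Rightarrow> nat \<Rightarrow> (nat \<times> nat) set \<Rightarrow> (nat \<Rightarrow> nat) set"
  where "box k n B = {p \<in> positions k n. \<forall>j<k. (j, p j) \<in> B}"

text \<open>If \<open>(j, l)\<close> is not in \<open>B\<close>, these are the positions that the box gains when this vertex is added.\<close>

definition star :: "nat \<Rightarrow> nat \<Rightarrow> (nat \<times> nat) set \<Rightarrow> nat \<Rightarrow> nat \<Rightarrow> (nat \<Rightarrow> nat) set"
  where "star k n B j l = {p \<in> positions k n. p j = l \<and> (\<forall>i<k. i \<noteq> j \<longrightarrow> (i, p i) \<in> B)}"

lemma finite_positions [simp]: "finite (positions k n)"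
  by (simp add: positions_def finite_PiE)

lemma card_positions: "card (positions k n) = n ^ k"
  by (simp add: positions_def card_PiE)

lemma positions_upd: "p \<in> positions k n \<Longrightarrow> j < k \<Longrightarrow> a < n \<Longrightarrow> p(j := a) \<in> positions k n"
  by (auto simp: positions_def PiE_iff extensional_def)

lemma positions_less: "p \<in> positions k n \<Longrightarrow> j < k \<Longrightarrow> p j < n"
  by (auto simp: positions_def)

lemma positions_ext: "p \<in> positions k n \<Longrightarrow> q \<in> positions k n \<Longrightarrow> (\<And>j. j < k \<Longrightarrow> p j = q j) \<Longrightarrow> p = q"
  unfolding positions_def by (rule PiE_ext) auto

lemma finite_slice: "B \<subseteq> {..<k} \<times> {..<n} \<Longrightarrow> finite (slice B j)"
  by (rule finite_subset[of _ "{..<n}"]) auto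

lemma card_positions_coordinatewise:
  assumes "\<And>i. i < k \<Longrightarrow> S i \<subseteq> {..<n}"
  shows "card {p \<in> positions k n. \<forall>i<k. p i \<in> S i} = (\<Prod>i<k. card (S i))"
proof -
  have "p i < n" if "i < k" "p i \<in> S i" for p i using assms that by blast
  then have "{p \<in> positions k n. \<forall>i<k. p i \<in> S i} = (\<Pi>\<^sub>E i\<in>{..<k}. S i)"
    by (auto simp: positions_def PiE_iff extensional_def)
  then show ?thesis by (simp add: card_PiE)
qed

lemma card_star:
  assumes "B \<subseteq> {..<k} \<times> {..<n}" "j < k" "l < n"
  shows "card (star k n B j l) = (\<Prod>i\<in>{..<k} - {j}. card (slice B i))"
proof -
  let ?S = "\<lambda>i. if i = j then {l} else slice B i"
  have "star k n B j l = {p \<in> positions k n. \<forall>i<k. p i \<in> ?S i}"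
    using assms(2) by (auto simp: star_def)
  also have "card \<dots> = (\<Prod>i<k. card (?S i))"
    by (rule card_positions_coordinatewise) (use assms in auto)
  also have "\<dots> = (\<Prod>i\<in>{..<k} - {j}. card (slice B i))"
    using assms by (subst prod.remove[of _ j]) auto
  finally show ?thesis .
qed

text \<open>The flattening at coordinate \<open>j\<close> has rank at most \<open>d\<close>: this is its factorization.\<close>

lemma cp_tensor_split:
  assumes "p \<in> positions k n" "j < k"
  shows "cp_tensor k n d x p = (\<Sum>i<d. x i j (p j) * (\<Prod>i'\<in>{..<k} - {j}. x i i' (p i')))"
  using assms by (simp add: cp_tensor_def prod.remove[of "{..<k}" j])

text \<open>For a new position \<open>p\<close> take \<open>d\<close> indices of coordinate \<open>j\<close> in the box as rows, the \<open>d\<close> positions in \<open>Q\<close>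
  as columns, and border this by the row \<open>l\<close> and the column \<open>p\<close>. All entries of the bordered array
  except the corner \<open>p\<close> lie in the box or in \<open>Q\<close>.\<close>

lemma box_grow:
  fixes x y :: "nat \<Rightarrow> nat \<Rightarrow> nat \<Rightarrow> 'a::field_char_0"
  assumes ind: "alg_independent_rat ({..<d} \<times> {..<k} \<times> {..<n}) (\<lambda>(i, j, l). x i j l)"
    and B: "B \<subseteq> {..<k} \<times> {..<n}" and j: "j < k" and l: "l < n" and rows: "d \<le> card (slice B j)"
    and agree: "\<And>p. p \<in> box k n B \<Longrightarrow> cp_tensor k n d y p = cp_tensor k n d x p"
    and Q: "Q \<subseteq> star k n B j l" "d \<le> card Q"
    and agreeQ: "\<And>p. p \<in> Q \<Longrightarrow> cp_tensor k n d y p = cp_tensor k n d x p"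
    and p: "p \<in> box k n (insert (j, l) B)"
  shows "cp_tensor k n d y p = cp_tensor k n d x p"
proof (cases "p \<in> box k n B")
  case True
  then show ?thesis by (rule agree)
next
  case False
  then have pj: "p j = l" and pstar: "p \<in> star k n B j l"
    using p by (auto simp: box_def star_def)
  have "finite Q" using Q(1) by (rule finite_subset) (simp add: star_def)
  then obtain q where q: "q ` {..<d} \<subseteq> Q" "inj_on q {..<d}"
    using card_le_inj[of "{..<d}" Q] Q by auto
  obtain r where r: "r ` {..<d} \<subseteq> slice B j" "inj_on r {..<d}"
    using card_le_inj[of "{..<d}" "slice B j"] finite_slice[OF B] rows by auto
  \<comment> \<open>Row and column \<open>d\<close> are the border.\<close>
  define r' where "r' a = (if a < d then r a else l)" for a
  define q' where "q' b = (if b < d then q b else p)" for b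
  have r': "(j, r' a) \<in> B" if "a < d" for a using r that by (auto simp: r'_def)
  have r'n: "r' a < n" for a using r'[of a] B l by (cases "a < d") (auto simp: r'_def)
  have q': "q' b \<in> star k n B j l" for b using q Q pstar by (auto simp: q'_def)
  have entry: "cp_tensor k n d z ((q' b)(j := r' a))
      = (\<Sum>i<d. z i j (r' a) * (\<Prod>i'\<in>{..<k} - {j}. z i i' (q' b i')))" for z :: "nat \<Rightarrow> nat \<Rightarrow> nat \<Rightarrow> 'a" and a b
  proof -
    have "(q' b)(j := r' a) \<in> positions k n"
      using q'[of b] r'n j by (intro positions_upd) (auto simp: star_def)
    from cp_tensor_split[OF this j] show ?thesis by simp
  qed
  have "(\<Sum>i<d. x i j (r' d) * (\<Prod>i'\<in>{..<k} - {j}. x i i' (q' d i')))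
      = (\<Sum>i<d. y i j (r' d) * (\<Prod>i'\<in>{..<k} - {j}. y i i' (q' d i')))"
  proof (rule bordered_entry)
    fix a b assume ab: "a \<le> d" "b \<le> d" "(a, b) \<noteq> (d, d)"
    have "cp_tensor k n d y ((q' b)(j := r' a)) = cp_tensor k n d x ((q' b)(j := r' a))"
    proof (cases "a < d")
      case True
      then have "(q' b)(j := r' a) \<in> box k n B"
        using q'[of b] r'[of a] r'n[of a] j by (auto simp: box_def star_def positions_upd)
      then show ?thesis by (rule agree)
    next
      case False
      then have "b < d" using ab by auto
      have "(q' b)(j := r' a) = q b"
        using False \<open>b < d\<close> q'[of b] by (auto simp: r'_def q'_def star_def)
      then show ?thesis using agreeQ q \<open>b < d\<close> by auto
    qed
    then show "(\<Sum>i<d. x i j (r' a) * (\<Prod>i'\<in>{..<k} - {j}. x i i' (q' b i')))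
      = (\<Sum>i<d. y i j (r' a) * (\<Prod>i'\<in>{..<k} - {j}. y i i' (q' b i')))"
      by (simp only: entry)
  next
    have "nonsing d (\<lambda>a i. \<Prod>j'\<in>{j}. x i j' (r' a))"
    proof (rule generic_minor_nonsing[OF ind])
      fix a b assume "a < d" "b < d" "a \<noteq> b"
      then show "\<exists>j'\<in>{j}. r' a \<noteq> r' b" using inj_onD[OF r(2), of a b] by (auto simp: r'_def)
    qed (use j r'n in auto)
    then show "nonsing d (\<lambda>a i. x i j (r' a))" by simp
  next
    show "nonsing d (\<lambda>b i. \<Prod>i'\<in>{..<k} - {j}. x i i' (q' b i'))"
    proof (rule generic_minor_nonsing[OF ind])
      fix a b assume ab: "a < d" "b < d" "a \<noteq> b"
      show "\<exists>i\<in>{..<k} - {j}. q' a i \<noteq> q' b i"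
      proof (rule ccontr)
        assume "\<not> ?thesis"
        then have "q' a i = q' b i" if "i < k" for i
          using q'[of a] q'[of b] that by (cases "i = j") (auto simp: star_def)
        then have "q' a = q' b"
          using q'[of a] q'[of b] by (intro positions_ext[of _ k n]) (auto simp: star_def)
        then show False using ab q(2) by (auto simp: q'_def inj_on_def)
      qed
    qed (use q' in \<open>auto simp: star_def intro: positions_less\<close>)
  qed
  then have "cp_tensor k n d y ((q' d)(j := r' d)) = cp_tensor k n d x ((q' d)(j := r' d))"
    by (simp only: entry)
  then show ?thesis using pj by (auto simp: q'_def r'_def)
qed

text \<open>Growth from \<open>A\<close> cannot stop at a maximal box of agreement unless that box is everything.\<close>

lemma box_grow_all:
  fixes x y :: "nat \<Rightarrow> nat \<Rightarrow> nat \<Rightarrow> 'a::field_char_0"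
  assumes ind: "alg_independent_rat ({..<d} \<times> {..<k} \<times> {..<n}) (\<lambda>(i, j, l). x i j l)"
    and A: "A \<subseteq> {..<k} \<times> {..<n}" "\<And>j. j < k \<Longrightarrow> d \<le> card (slice A j)"
    and agreeA: "\<And>p. p \<in> box k n A \<Longrightarrow> cp_tensor k n d y p = cp_tensor k n d x p"
    and step: "\<And>B. A \<subseteq> B \<Longrightarrow> B \<subset> {..<k} \<times> {..<n} \<Longrightarrow>
      \<exists>(j, l)\<in>{..<k} \<times> {..<n} - B. d \<le> card {p \<in> star k n B j l. cp_tensor k n d y p = cp_tensor k n d x p}"
    and p: "p \<in> positions k n"
  shows "cp_tensor k n d y p = cp_tensor k n d x p"
proof -
  let ?V = "{..<k} \<times> {..<n}"
  let ?F = "{B. A \<subseteq> B \<and> B \<subseteq> ?V \<and> (\<forall>p\<in>box k n B. cp_tensor k n d y p = cp_tensor k n d x p)}"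
  have "finite ?F" by (rule finite_subset[of _ "Pow ?V"]) auto
  moreover have "A \<in> ?F" using A agreeA by blast
  ultimately obtain B where B: "B \<in> ?F" and max: "\<forall>C\<in>?F. B \<subseteq> C \<longrightarrow> B = C"
    using finite_has_maximal[of ?F] by (metis (no_types, lifting) empty_iff)
  have "B = ?V"
  proof (rule ccontr)
    assume "B \<noteq> ?V"
    with B(1) step[of B] obtain j l where jl: "j < k" "l < n" "(j, l) \<notin> B"
      and Q: "d \<le> card {p \<in> star k n B j l. cp_tensor k n d y p = cp_tensor k n d x p}"
      by auto
    have "card (slice A j) \<le> card (slice B j)"
      using B(1) by (intro card_mono finite_slice[of _ k n]) auto
    then have "d \<le> card (slice B j)" using A(2)[OF jl(1)] by simp
    then have "cp_tensor k n d y p = cp_tensor k n d x p" if "p \<in> box k n (insert (j, l) B)" for p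
      using B(1) by (intro box_grow[OF ind _ jl(1,2) _ _ _ Q _ that]) auto
    then have "insert (j, l) B \<in> ?F" using B(1) jl by auto
    with max have "B = insert (j, l) B" by blast
    with jl(3) show False by blast
  qed
  then have "p \<in> box k n B" using p by (auto simp: box_def positions_less)
  then show ?thesis using B(1) by auto
qed

section \<open>Boxes in dense sets of positions\<close>

lemma card_le_positions:
  assumes "W \<subseteq> positions k n"
  shows "real (card W) \<le> real n ^ k"
proof -
  have "card W \<le> n ^ k"
    using card_mono[OF finite_positions assms] by (simp add: card_positions)
  then have "real (card W) \<le> real (n ^ k)" by (rule of_nat_mono)
  then show ?thesis by simp
qed

text \<open>Exchanging the value of coordinate \<open>j\<close> with an external value \<open>a\<close> is an involution on pairs of a
  position and a value.\<close>

lemma sum_swap_coordinate: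
  fixes h :: "(nat \<Rightarrow> nat) \<Rightarrow> nat \<Rightarrow> 'b::comm_monoid_add"
  assumes "j < k"
  shows "(\<Sum>p\<in>positions k n. \<Sum>a<n. h (p(j := a)) (p j)) = (\<Sum>p\<in>positions k n. \<Sum>a<n. h p a)"
proof -
  have "(\<Sum>(p, a)\<in>positions k n \<times> {..<n}. h (p(j := a)) (p j)) = (\<Sum>(p, a)\<in>positions k n \<times> {..<n}. h p a)"
    using assms
    by (intro sum.reindex_bij_witness[where i = "\<lambda>(p, a). (p(j := a), p j)" and j = "\<lambda>(p, a). (p(j := a), p j)"])
       (auto simp: positions_upd positions_less)
  then show ?thesis by (simp add: sum.cartesian_product)
qed

text \<open>Let \<open>D p\<close> count the points of \<open>W\<close> on the line through \<open>p\<close> in direction \<open>j\<close>. The left-hand side is the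
  sum of \<open>D\<close> over \<open>W\<close>, which is the sum of \<open>(D p)\<^sup>2\<close> over all positions divided by \<open>n\<close>, and
  Cauchy--Schwarz bounds it below.\<close>

lemma sum_popularity:
  assumes W: "W \<subseteq> positions k n" and j: "j < k" and n: "n > 0"
    and dense: "real (card W) \<ge> \<epsilon> * real n ^ k" and \<epsilon>: "\<epsilon> \<ge> 0"
  shows "(\<Sum>a<n. real (card {p\<in>W. p(j := a) \<in> W})) \<ge> \<epsilon>\<^sup>2 * real n ^ (k + 1)"
proof -
  define w where "w p = (if p \<in> W then 1 else 0 :: real)" for p
  define D where "D p = (\<Sum>a<n. w (p(j := a)))" for p
  have cardW: "(\<Sum>p\<in>positions k n. w p) = card W"
    using W by (simp add: w_def sum.If_cases Int_absorb1)
  have DD: "D (p(j := a)) = D p" for p a by (simp add: D_def)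
  have "(\<Sum>p\<in>positions k n. D p) = (\<Sum>p\<in>positions k n. \<Sum>a<n. w p)"
    unfolding D_def by (rule sum_swap_coordinate[OF j, of "\<lambda>p a. w p"])
  then have 1: "(\<Sum>p\<in>positions k n. D p) = real n * real (card W)"
    by (simp add: cardW flip: sum_distrib_left)
  have "(\<Sum>p\<in>positions k n. (D p)\<^sup>2) = (\<Sum>p\<in>positions k n. \<Sum>a<n. w (p(j := a)) * D (p(j := a)))"
    by (simp add: DD power2_eq_square sum_distrib_right D_def[of p for p])
  also have "\<dots> = (\<Sum>p\<in>positions k n. \<Sum>a<n. w p * D p)"
    by (rule sum_swap_coordinate[OF j, of "\<lambda>p a. w p * D p"])
  finally have 2: "(\<Sum>p\<in>positions k n. (D p)\<^sup>2) = n * (\<Sum>p\<in>positions k n. w p * D p)"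
    by (simp add: sum_distrib_left)
  have "(real n * card W)\<^sup>2 \<le> (\<Sum>p\<in>positions k n. (D p)\<^sup>2) * real (card (positions k n))"
    unfolding 1[symmetric] by (rule sum_squared_le_sum_of_squares)
  then have "real n * (real n * (real (card W))\<^sup>2) \<le> real n * ((\<Sum>p\<in>positions k n. w p * D p) * real n ^ k)"
    unfolding 2 by (simp add: card_positions power2_eq_square mult_ac)
  then have 3: "real n * (real (card W))\<^sup>2 \<le> (\<Sum>p\<in>positions k n. w p * D p) * real n ^ k"
    using n by simp
  have "(\<epsilon> * real n ^ k)\<^sup>2 \<le> (real (card W))\<^sup>2"
    using dense \<epsilon> by (intro power_mono) auto
  then have "real n * (\<epsilon> * real n ^ k)\<^sup>2 \<le> (\<Sum>p\<in>positions k n. w p * D p) * real n ^ k"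
    using 3 by (meson mult_left_mono of_nat_0_le_iff order_trans)
  then have "(\<epsilon>\<^sup>2 * real n ^ (k + 1)) * real n ^ k \<le> (\<Sum>p\<in>positions k n. w p * D p) * real n ^ k"
    by (simp add: power_mult_distrib power2_eq_square mult_ac)
  then have "\<epsilon>\<^sup>2 * real n ^ (k + 1) \<le> (\<Sum>p\<in>positions k n. w p * D p)"
    using n by (simp only: mult_le_cancel_right_pos zero_less_power of_nat_0_less_iff)
  also have "\<dots> = (\<Sum>p\<in>positions k n. \<Sum>a<n. w p * w (p(j := a)))"
    by (simp add: D_def sum_distrib_left)
  also have "\<dots> = (\<Sum>a<n. \<Sum>p\<in>positions k n. w p * w (p(j := a)))"
    by (rule sum.swap)
  also have "\<dots> = (\<Sum>a<n. real (card {p\<in>W. p(j := a) \<in> W}))"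
  proof (rule sum.cong[OF refl])
    fix a
    have "(\<Sum>p\<in>positions k n. w p * w (p(j := a))) = (\<Sum>p\<in>positions k n. if p \<in> {p\<in>W. p(j := a) \<in> W} then 1 else 0)"
      by (intro sum.cong refl) (auto simp: w_def)
    also have "\<dots> = real (card (positions k n \<inter> {p\<in>W. p(j := a) \<in> W}))"
      by (simp add: sum.If_cases)
    also have "positions k n \<inter> {p\<in>W. p(j := a) \<in> W} = {p\<in>W. p(j := a) \<in> W}" using W by auto
    finally show "(\<Sum>p\<in>positions k n. w p * w (p(j := a))) = real (card {p\<in>W. p(j := a) \<in> W})" .
  qed
  finally show ?thesis .
qed

text \<open>The few forbidden values contribute at most half of the sum in the previous lemma, so an average
  allowed value is popular.\<close>

lemma popular_value:
  assumes W: "W \<subseteq> positions k n" and j: "j < k" and n: "n > 0"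
    and dense: "real (card W) \<ge> \<epsilon> * real n ^ k" and \<epsilon>: "\<epsilon> > 0"
    and F: "F \<subseteq> {..<n}" "real (card F) \<le> \<epsilon>\<^sup>2 / 2 * n"
  obtains a where "a < n" "a \<notin> F" "real (card {p\<in>W. p(j := a) \<in> W}) \<ge> \<epsilon>\<^sup>2 / 2 * real n ^ k"
proof (rule ccontr)
  let ?N = "\<lambda>a. real (card {p\<in>W. p(j := a) \<in> W})"
  note found = that
  assume "\<not> thesis"
  then have less: "?N a < \<epsilon>\<^sup>2 / 2 * real n ^ k" if "a < n" "a \<notin> F" for a
    using \<open>\<not> thesis\<close> found[OF that] by (meson not_le)
  have all: "?N a \<le> real n ^ k" for a
    using W by (intro card_le_positions) auto
  have finF: "finite F" using F(1) by (rule finite_subset) simp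
  have "F \<noteq> {..<n}"
  proof
    assume "F = {..<n}"
    then have "1 * real n \<le> \<epsilon>\<^sup>2 / 2 * n" using F by simp
    then have "1 \<le> \<epsilon>\<^sup>2 / 2" using n by (simp only: mult_le_cancel_right_pos of_nat_0_less_iff)
    moreover have "\<epsilon> * real n ^ k \<le> real n ^ k" 
      using dense card_le_positions[OF W] by linarith
    then have "\<epsilon> \<le> 1" using n by (simp add: mult_le_cancel_right1)
    then have "\<epsilon>\<^sup>2 \<le> 1" using \<epsilon> by (simp add: power_le_one)
    ultimately show False by simp
  qed
  then have ne: "{..<n} - F \<noteq> {}" using F by auto
  have "(\<Sum>a<n. ?N a) = (\<Sum>a\<in>F. ?N a) + (\<Sum>a\<in>{..<n} - F. ?N a)"
    using sum.subset_diff[OF F(1), of ?N] by simp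
  also have "(\<Sum>a\<in>F. ?N a) \<le> card F * real n ^ k"
    using sum_bounded_above[of F ?N "real n ^ k"] all by simp
  also have "card F * real n ^ k \<le> (\<epsilon>\<^sup>2 / 2 * n) * real n ^ k"
    using F(2) by (intro mult_right_mono) auto
  also have "(\<Sum>a\<in>{..<n} - F. ?N a) < (\<Sum>a\<in>{..<n} - F. \<epsilon>\<^sup>2 / 2 * real n ^ k)"
    using ne less by (intro sum_strict_mono) auto
  also have "(\<Sum>a\<in>{..<n} - F. \<epsilon>\<^sup>2 / 2 * real n ^ k) \<le> real n * (\<epsilon>\<^sup>2 / 2 * real n ^ k)"
    using card_mono[of "{..<n}" "{..<n} - F"] by (simp add: mult_right_mono del: card_Diff_subset)
  finally have "(\<Sum>a<n. ?N a) < \<epsilon>\<^sup>2 * real n ^ (k + 1)" by (simp add: algebra_simps)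
  then show False using sum_popularity[OF W j n dense] \<epsilon> by simp
qed

text \<open>Every position of \<open>W\<close> may have any of its coordinates replaced by values from \<open>A\<close> without leaving \<open>Z\<close>.
  If \<open>W\<close> is nonempty, \<open>Z\<close> contains the box of \<open>A\<close>, and also the box of \<open>A\<close> enlarged by a single vertex of a
  position in \<open>W\<close>; keeping \<open>W\<close> dense thus provides many such vertices in every coordinate at once.\<close>

definition padding :: "nat \<Rightarrow> nat \<Rightarrow> (nat \<Rightarrow> nat) set \<Rightarrow> (nat \<times> nat) set \<Rightarrow> (nat \<Rightarrow> nat) set \<Rightarrow> bool"
  where "padding k n Z A W \<longleftrightarrow> A \<subseteq> {..<k} \<times> {..<n} \<and> W \<subseteq> Z \<and>
    (\<forall>p\<in>W. \<forall>q\<in>positions k n. (\<forall>j<k. q j = p j \<or> (j, q j) \<in> A) \<longrightarrow> q \<in> Z)"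

lemma padding_empty:
  assumes "Z \<subseteq> positions k n"
  shows "padding k n Z {} Z"
proof -
  have "q = p" if "p \<in> Z" "q \<in> positions k n" "\<forall>j<k. q j = p j" for p q
    using that assms by (intro positions_ext[of _ k n]) auto
  then show ?thesis unfolding padding_def by auto
qed

lemma padding_insert:
  assumes "padding k n Z A W" "j < k" "a < n"
  shows "padding k n Z (insert (j, a) A) {p\<in>W. p(j := a) \<in> W}"
proof -
  have *: "q \<in> Z" if "p \<in> W" "q \<in> positions k n" "\<And>i. i < k \<Longrightarrow> q i = p i \<or> (i, q i) \<in> A" for p q
    using assms(1) that unfolding padding_def by blast
  have "q \<in> Z" if p: "p \<in> W" "p(j := a) \<in> W" and q: "q \<in> positions k n"
    "\<forall>i<k. q i = p i \<or> (i, q i) \<in> insert (j, a) A" for p q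
  proof (cases "q j = a")
    case True
    then show ?thesis using p q by (intro *[of "p(j := a)"]) auto
  next
    case False
    then show ?thesis using p q by (intro *[of p]) auto
  qed
  then show ?thesis using assms unfolding padding_def by auto
qed

text \<open>Vertices are added to \<open>A\<close> one by one, for the coordinates listed in \<open>js\<close>; a popular value keeps \<open>W\<close>
  dense, at the price of passing from density \<open>\<delta>\<close> to \<open>\<delta>\<^sup>2 / 2\<close>. The number of steps does not depend on \<open>n\<close>.\<close>

lemma dense_contains_boxes:
  assumes "set js \<subseteq> {..<k}" "\<epsilon> > 0"
  shows "\<exists>\<delta>>0. \<exists>n0. \<forall>n\<ge>n0. \<forall>Z\<subseteq>positions k n. real (card Z) \<ge> \<epsilon> * real n ^ k \<longrightarrow>
    (\<exists>A W. padding k n Z A W \<and> real (card W) \<ge> \<delta> * real n ^ k \<and>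
      (\<forall>j. card (slice A j) = count_list js j))"
  using assms(1)
proof (induction js)
  case Nil
  have "\<exists>A W. padding k n Z A W \<and> real (card W) \<ge> \<epsilon> * real n ^ k \<and> (\<forall>j. card (slice A j) = count_list [] j)"
    if "Z \<subseteq> positions k n" "real (card Z) \<ge> \<epsilon> * real n ^ k" for n Z
    by (intro exI[of _ "{}"] exI[of _ Z]) (use that in \<open>auto intro: padding_empty\<close>)
  then show ?case using \<open>\<epsilon> > 0\<close> by blast
next
  case (Cons j js)
  then have "set js \<subseteq> {..<k}" and j: "j < k" by auto
  from Cons.IH[OF this(1)] obtain \<delta> n0 where \<delta>: "\<delta> > 0"
    and IH: "\<forall>n\<ge>n0. \<forall>Z\<subseteq>positions k n. real (card Z) \<ge> \<epsilon> * real n ^ k \<longrightarrow>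
      (\<exists>A W. padding k n Z A W \<and> real (card W) \<ge> \<delta> * real n ^ k \<and>
        (\<forall>j. card (slice A j) = count_list js j))"
    by blast
  \<comment> \<open>For \<open>n \<ge> c\<close> the values already chosen for coordinate \<open>j\<close> are few enough to be avoided.\<close>
  define c where "c = nat \<lceil>2 * count_list js j / \<delta>\<^sup>2\<rceil>"
  show ?case
  proof (intro exI[of _ "\<delta>\<^sup>2 / 2"] conjI exI[of _ "max n0 (max 1 c)"] allI impI)
    fix n Z assume n: "n \<ge> max n0 (max 1 c)" and Z: "Z \<subseteq> positions k n" "real (card Z) \<ge> \<epsilon> * real n ^ k"
    have n': "n \<ge> n0" "n > 0" "n \<ge> c" using n by auto
    from IH n'(1) Z obtain A W where pad: "padding k n Z A W" and W: "real (card W) \<ge> \<delta> * real n ^ k"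
      and cA: "\<forall>j. card (slice A j) = count_list js j"
      by blast
    have A: "A \<subseteq> {..<k} \<times> {..<n}" and WZ: "W \<subseteq> positions k n"
      using pad Z(1) unfolding padding_def by auto
    have "2 * count_list js j / \<delta>\<^sup>2 \<le> n" using n'(3) unfolding c_def by linarith
    then have cn: "real (card (slice A j)) \<le> \<delta>\<^sup>2 / 2 * n" using \<delta> cA by (simp add: field_simps)
    have sl: "slice A j \<subseteq> {..<n}" using A by auto
    obtain a where a: "a < n" "a \<notin> slice A j" "real (card {p\<in>W. p(j := a) \<in> W}) \<ge> \<delta>\<^sup>2 / 2 * real n ^ k"
      using popular_value[OF WZ j n'(2) W \<delta> sl cn] by blast
    let ?A = "insert (j, a) A" and ?W = "{p\<in>W. p(j := a) \<in> W}"
    have slice: "slice ?A i = (if i = j then insert a (slice A i) else slice A i)" for i by auto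
    have "card (slice ?A i) = count_list (j # js) i" for i
      unfolding slice using a(2) finite_slice[OF A, of i] cA by auto
    then show "\<exists>A W. padding k n Z A W \<and> real (card W) \<ge> \<delta>\<^sup>2 / 2 * real n ^ k \<and>
      (\<forall>i. card (slice A i) = count_list (j # js) i)"
      using padding_insert[OF pad j a(1)] a(3) by blast
  qed (use \<delta> in simp)
qed

section \<open>From dense agreement to equality\<close>

text \<open>No proper set of vertices with at least \<open>\<beta> * n\<close> vertices in each coordinate is a dead end for growth by
  means of \<open>\<Omega>\<close>.\<close>

definition expanding :: "nat \<Rightarrow> nat \<Rightarrow> nat \<Rightarrow> real \<Rightarrow> (nat \<Rightarrow> nat) set \<Rightarrow> bool"
  where "expanding k n d \<beta> \<Omega> \<longleftrightarrow>
    (\<forall>B. B \<subset> {..<k} \<times> {..<n} \<longrightarrow> (\<forall>j<k. \<beta> * n \<le> card (slice B j)) \<longrightarrow>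
      (\<exists>(j, l)\<in>{..<k} \<times> {..<n} - B. d \<le> card (\<Omega> \<inter> star k n B j l)))"

lemma card_positions_in_slice:
  assumes "j < k" "S \<subseteq> {..<n}"
  shows "card {p \<in> positions k n. p j \<in> S} = card S * n ^ (k - 1)"
proof -
  let ?S = "\<lambda>i. if i = j then S else {..<n}"
  have "{p \<in> positions k n. p j \<in> S} = {p \<in> positions k n. \<forall>i<k. p i \<in> ?S i}"
    using assms(1) by (auto intro: positions_less)
  then have "card {p \<in> positions k n. p j \<in> S} = (\<Prod>i<k. card (?S i))"
    using assms card_positions_coordinatewise[of k ?S n] by simp
  also have "\<dots> = card S * (\<Prod>i\<in>{..<k} - {j}. card (if i = j then S else {..<n}))"
    using assms by (subst prod.remove[of _ j]) auto
  also have "(\<Prod>i\<in>{..<k} - {j}. card (if i = j then S else {..<n})) = n ^ (k - 1)"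
    using assms by simp
  finally show ?thesis .
qed

lemma exists_list_counts:
  fixes k d :: nat
  shows "\<exists>js. set js \<subseteq> {..<k} \<and> (\<forall>j<k. count_list js j = d)"
proof (induction k)
  case (Suc k)
  then obtain js where js: "set js \<subseteq> {..<k}" "\<forall>j<k. count_list js j = d" by blast
  have "count_list (replicate d k) j = (if j = k then d else 0)" for j
    by (induction d) auto
  moreover have "count_list js k = 0" using js(1) by (auto simp: count_list_0_iff)
  ultimately show ?case using js
    by (intro exI[of _ "replicate d k @ js"]) (auto simp: less_Suc_eq)
qed auto

text \<open>Let \<open>Z\<close> be the set of agreement and \<open>A\<close>, \<open>W\<close> a padding of it with \<open>d\<close> vertices of \<open>A\<close> in each coordinate.
  A box of agreement that contains \<open>A\<close> but misses a vertex of some position in \<open>W\<close> can grow by this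
  vertex: it lies on \<open>d ^ (k - 1) \<ge> d\<close> positions of \<open>Z\<close> with other vertices in \<open>A\<close>. A box that contains all
  vertices of \<open>W\<close> has linearly many vertices in each coordinate, as \<open>W\<close> is dense, and grows by expansion.\<close>

lemma agreement_propagates:
  assumes k: "k \<ge> 2" and \<epsilon>: "\<epsilon> > 0"
  shows "\<exists>\<beta>>0. \<exists>n0. \<forall>n\<ge>n0. \<forall>(x :: nat \<Rightarrow> nat \<Rightarrow> nat \<Rightarrow> 'a::field_char_0) y \<Omega>.
    alg_independent_rat ({..<d} \<times> {..<k} \<times> {..<n}) (\<lambda>(i, j, l). x i j l) \<longrightarrow>
    expanding k n d \<beta> \<Omega> \<longrightarrow>
    (\<forall>p\<in>\<Omega>. cp_tensor k n d y p = cp_tensor k n d x p) \<longrightarrow>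
    \<epsilon> * real n ^ k \<le> card {p \<in> positions k n. cp_tensor k n d y p = cp_tensor k n d x p} \<longrightarrow>
    cp_tensor k n d y = cp_tensor k n d x"
proof -
  obtain js where js: "set js \<subseteq> {..<k}" "\<forall>j<k. count_list js j = d"
    using exists_list_counts by blast
  from dense_contains_boxes[OF js(1) \<epsilon>] obtain \<delta> n0 where \<delta>: "\<delta> > 0"
    and boxes: "\<forall>n\<ge>n0. \<forall>Z\<subseteq>positions k n. \<epsilon> * real n ^ k \<le> real (card Z) \<longrightarrow>
      (\<exists>A W. padding k n Z A W \<and> \<delta> * real n ^ k \<le> real (card W) \<and> (\<forall>j. card (slice A j) = count_list js j))"
    by blast
  have "cp_tensor k n d y = cp_tensor k n d x"
    if n: "n \<ge> max 1 n0" and ind: "alg_independent_rat ({..<d} \<times> {..<k} \<times> {..<n}) (\<lambda>(i, j, l). x i j l)"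
      and ex: "expanding k n d \<delta> \<Omega>"
      and agree: "\<forall>p\<in>\<Omega>. cp_tensor k n d y p = cp_tensor k n d x p"
      and dense: "\<epsilon> * real n ^ k \<le> card {p \<in> positions k n. cp_tensor k n d y p = cp_tensor k n d x p}"
    for n and x y :: "nat \<Rightarrow> nat \<Rightarrow> nat \<Rightarrow> 'a" and \<Omega>
  proof -
    let ?V = "{..<k} \<times> {..<n}"
    define Z where "Z = {p \<in> positions k n. cp_tensor k n d y p = cp_tensor k n d x p}"
    have n': "n \<ge> n0" "n > 0" using n by auto
    have "Z \<subseteq> positions k n" by (auto simp: Z_def)
    with boxes n'(1) dense obtain A W where pad: "padding k n Z A W"
      and W: "\<delta> * real n ^ k \<le> real (card W)" and cA: "\<forall>j. card (slice A j) = count_list js j"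
      unfolding Z_def by blast
    have A: "A \<subseteq> ?V" and WZ: "W \<subseteq> Z"
      and sur: "\<And>p q. p \<in> W \<Longrightarrow> q \<in> positions k n \<Longrightarrow> \<forall>j<k. q j = p j \<or> (j, q j) \<in> A \<Longrightarrow> q \<in> Z"
      using pad unfolding padding_def by blast+
    have "card W > 0" using W \<delta> n'(2) by (metis mult_pos_pos of_nat_0_less_iff order_less_le_trans zero_less_power)
    then obtain p0 where p0: "p0 \<in> W" by fastforce
    have eq: "cp_tensor k n d y p = cp_tensor k n d x p" if p: "p \<in> positions k n" for p
    proof (rule box_grow_all[OF ind A _ _ _ p])
      show "d \<le> card (slice A j)" if "j < k" for j using cA js that by simp
      show "cp_tensor k n d y q = cp_tensor k n d x q" if "q \<in> box k n A" for q
        using sur[OF p0, of q] that by (auto simp: box_def Z_def)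
    next
      fix B assume B: "A \<subseteq> B" "B \<subset> ?V"
      let ?agree = "\<lambda>j l. {p \<in> star k n B j l. cp_tensor k n d y p = cp_tensor k n d x p}"
      have fin: "finite (?agree j l)" for j l by (simp add: star_def)
      show "\<exists>(j, l)\<in>?V - B. d \<le> card (?agree j l)"
      proof (cases "\<exists>p\<in>W. \<exists>j<k. (j, p j) \<notin> B")
        case True
        then obtain p j where pj: "p \<in> W" "j < k" "(j, p j) \<notin> B" by blast
        have pn: "p j < n" using pj WZ by (auto simp: Z_def intro: positions_less)
        have "card (star k n A j (p j)) = (\<Prod>i\<in>{..<k} - {j}. card (slice A i))"
          by (rule card_star[OF A pj(2) pn])
        also have "\<dots> = d ^ (k - 1)" using cA js pj(2) by simp
        finally have "card (star k n A j (p j)) = d ^ (k - 1)" .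
        moreover have "d \<le> d ^ (k - 1)" using k by (cases "d = 0") (auto intro: self_le_power)
        moreover have "star k n A j (p j) \<subseteq> ?agree j (p j)"
        proof
          fix q assume q: "q \<in> star k n A j (p j)"
          then have "q \<in> Z" using sur[OF pj(1), of q] by (auto simp: star_def)
          then show "q \<in> ?agree j (p j)" using q B by (auto simp: star_def Z_def)
        qed
        ultimately have "d \<le> card (?agree j (p j))" using card_mono[OF fin, of "star k n A j (p j)" j "p j"] by linarith
        then show ?thesis using pj pn by (intro bexI[of _ "(j, p j)"]) auto
      next
        case False
        have "\<delta> * n \<le> card (slice B j)" if "j < k" for j
        proof -
          have "W \<subseteq> {p \<in> positions k n. p j \<in> slice B j}"
            using False WZ that by (auto simp: Z_def)
          then have "card W \<le> card (slice B j) * n ^ (k - 1)"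
            using B card_mono[of "{p \<in> positions k n. p j \<in> slice B j}" W]
              card_positions_in_slice[OF that, of "slice B j" n] by fastforce
          then have "real (card W) \<le> real (card (slice B j) * n ^ (k - 1))" by (rule of_nat_mono)
          with W have "(\<delta> * n) * real n ^ (k - 1) \<le> card (slice B j) * real n ^ (k - 1)"
            using k by (cases k) (auto simp: mult.assoc)
          then show ?thesis using n'(2) by (simp add: mult_le_cancel_right)
        qed
        then have "\<exists>(j, l)\<in>?V - B. d \<le> card (\<Omega> \<inter> star k n B j l)"
          using ex B(2) unfolding expanding_def by simp
        then obtain j l where jl: "(j, l) \<in> ?V - B" "d \<le> card (\<Omega> \<inter> star k n B j l)" by auto
        have "card (\<Omega> \<inter> star k n B j l) \<le> card (?agree j l)"
          using agree by (intro card_mono fin) auto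
        then show ?thesis using jl by (intro bexI[of _ "(j, l)"]) auto
      qed
    qed
    show ?thesis
    proof
      fix p show "cp_tensor k n d y p = cp_tensor k n d x p"
        using eq[of p] by (cases "p \<in> positions k n") (auto simp: cp_tensor_def)
    qed
  qed
  then show ?thesis using \<delta> by blast
qed

section \<open>Tensors of bounded rank\<close>

text \<open>The rank is a least number of terms, so it means nothing before some decomposition is known: write
  \<open>S\<close> as a sum over positions of multiples of unit tensors.\<close>

lemma tensor_has_decomposition:
  fixes S :: "(nat \<Rightarrow> nat) \<Rightarrow> 'a::field_char_0"
  assumes k: "k \<ge> 1" and S: "S \<in> tensors k n"
  shows "\<exists>r x. S = cp_tensor k n r x"
proof -
  obtain h where h: "bij_betw h {..<card (positions k n)} (positions k n)"
    using ex_bij_betw_nat_finite[OF finite_positions] by (auto simp: lessThan_atLeast0)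
  define x where "x i j l = (if l = h i j then if j = 0 then S (h i) else 1 else 0)" for i j l
  have hp: "h i \<in> positions k n" if "i < card (positions k n)" for i
    using h that by (auto simp: bij_betw_def)
  have "cp_tensor k n (card (positions k n)) x p = S p" if p: "p \<in> positions k n" for p
  proof -
    have rank_one: "(\<Prod>j<k. x i j (p j)) = (if h i = p then S p else 0)" if i: "i < card (positions k n)" for i
    proof (cases "h i = p")
      case True
      have "(\<Prod>j<k. x i j (p j)) = (\<Prod>j\<in>{0}. x i j (p j))"
        using k by (intro prod.mono_neutral_right) (auto simp: x_def True)
      then show ?thesis using True by (simp add: x_def)
    next
      case False
      then obtain j where "j < k" "h i j \<noteq> p j" using positions_ext[OF hp[OF i] p] by blast
      then have "x i j (p j) = 0" by (simp add: x_def)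
      then have "(\<Prod>j<k. x i j (p j)) = 0" using \<open>j < k\<close> by (intro prod_zero) auto
      then show ?thesis using False by simp
    qed
    have "cp_tensor k n (card (positions k n)) x p = (\<Sum>i<card (positions k n). if h i = p then S p else 0)"
      using p rank_one by (simp add: cp_tensor_def)
    also have "\<dots> = (\<Sum>q\<in>positions k n. if q = p then S p else 0)"
      by (rule sum.reindex_bij_betw[OF h])
    finally show ?thesis using p by simp
  qed
  then have "S = cp_tensor k n (card (positions k n)) x"
    using S by (intro ext) (auto simp: tensors_def cp_tensor_def PiE_iff extensional_def)
  then show ?thesis by blast
qed

lemma cp_rank_le_imp_decomposition:
  fixes S :: "(nat \<Rightarrow> nat) \<Rightarrow> 'a::field_char_0"
  assumes k: "k \<ge> 1" and S: "S \<in> tensors k n" and rank: "cp_rank k n S \<le> d"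
  shows "\<exists>y. S = cp_tensor k n d y"
proof -
  obtain x where x: "S = cp_tensor k n (cp_rank k n S) x"
    using LeastI_ex[OF tensor_has_decomposition[OF k S]] unfolding cp_rank_def by blast
  define y where "y i = (if i < cp_rank k n S then x i else (\<lambda>j l. 0))" for i
  have "(\<Sum>i<d. \<Prod>j<k. y i j (p j)) = (\<Sum>i<cp_rank k n S. \<Prod>j<k. x i j (p j))" for p
  proof -
    have "(\<Sum>i<d. \<Prod>j<k. y i j (p j)) = (\<Sum>i<cp_rank k n S. \<Prod>j<k. y i j (p j))"
      using rank k by (intro sum.mono_neutral_right) (auto simp: y_def)
    then show ?thesis by (simp add: y_def)
  qed
  then have "cp_tensor k n d y = S" by (subst x) (simp add: cp_tensor_def)
  then show ?thesis by metis
qed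

section \<open>Zero patterns of polynomials\<close>

definition monomial :: "'v set \<Rightarrow> ('v \<Rightarrow> nat) \<Rightarrow> ('v \<Rightarrow> 'a::field) \<Rightarrow> 'a"
  where "monomial V e y = (\<Prod>v\<in>V. y v ^ e v)"

interpretation func: vector_space "\<lambda>(c::'a::field) (f::'b \<Rightarrow> 'a) y. c * f y"
  by unfold_locales (auto simp: fun_eq_iff algebra_simps)

text \<open>Polynomial functions of degree at most \<open>D\<close> in each variable separately. Bounding each degree, rather
  than the total degree, makes the dimension easy to count, and it is accurate enough.\<close>

abbreviation poly_space :: "'v set \<Rightarrow> nat \<Rightarrow> (('v \<Rightarrow> 'a::field) \<Rightarrow> 'a) set"
  where "poly_space V D \<equiv> func.span (monomial V ` (V \<rightarrow>\<^sub>E {..D}))"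

lemma poly_space_mult:
  assumes f: "f \<in> poly_space V D" and g: "g \<in> poly_space V E"
  shows "(\<lambda>y. f y * g y) \<in> poly_space V (D + E)"
proof -
  have 1: "(\<lambda>y. monomial V d y * g y) \<in> poly_space V (D + E)" if "d \<in> V \<rightarrow>\<^sub>E {..D}" for d
    using g
  proof (induction rule: func.span_induct_alt)
    case base
    then show ?case using func.span_zero by (simp add: zero_fun_def)
  next
    case (step c h h')
    then obtain e where e: "e \<in> V \<rightarrow>\<^sub>E {..E}" "h = monomial V e" by auto
    let ?s = "\<lambda>v\<in>V. d v + e v"
    have "monomial V ?s \<in> poly_space V (D + E)"
      using that e by (intro func.span_base imageI) (auto simp: PiE_iff extensional_def intro!: add_mono)
    then have "(\<lambda>y. c * monomial V ?s y) + (\<lambda>y. monomial V d y * h' y) \<in> poly_space V (D + E)"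
      using step by (intro func.span_add func.span_scale) auto
    also have "(\<lambda>y. c * monomial V ?s y) + (\<lambda>y. monomial V d y * h' y)
        = (\<lambda>y. monomial V d y * ((\<lambda>y. c * h y) + h') y)"
      by (auto simp: fun_eq_iff e monomial_def power_add prod.distrib algebra_simps)
    finally show ?case .
  qed
  show ?thesis using f
  proof (induction rule: func.span_induct_alt)
    case base
    then show ?case using func.span_zero by (simp add: zero_fun_def)
  next
    case (step c h h')
    then have "(\<lambda>y. h y * g y) \<in> poly_space V (D + E)" using 1 by auto
    then have "(\<lambda>y. c * (h y * g y)) + (\<lambda>y. h' y * g y) \<in> poly_space V (D + E)"
      using step by (intro func.span_add func.span_scale) auto
    also have "(\<lambda>y. c * (h y * g y)) + (\<lambda>y. h' y * g y) = (\<lambda>y. ((\<lambda>y. c * h y) + h') y * g y)"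
      by (auto simp: fun_eq_iff algebra_simps)
    finally show ?case .
  qed
qed

lemma poly_space_mono: "D \<le> E \<Longrightarrow> poly_space V D \<subseteq> poly_space V E"
  by (intro func.span_mono image_mono PiE_mono) auto

lemma poly_space_const: "(\<lambda>y. c) \<in> poly_space V D"
proof -
  have "monomial V (\<lambda>v\<in>V. 0) \<in> poly_space V D"
    by (intro func.span_base imageI) auto
  then have "(\<lambda>y. c * monomial V (\<lambda>v\<in>V. 0) y) \<in> poly_space V D" by (rule func.span_scale)
  moreover have "(\<lambda>y. c * monomial V (\<lambda>v\<in>V. 0) y) = (\<lambda>y. c)"
    by (simp add: monomial_def)
  ultimately show ?thesis by simp
qed

lemma poly_space_prod:
  assumes "finite P" "\<And>p. p \<in> P \<Longrightarrow> f p \<in> poly_space V 1"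
  shows "(\<lambda>y. \<Prod>p\<in>P. f p y) \<in> poly_space V (card P)"
  using assms
proof (induction P rule: finite_induct)
  case empty
  show ?case unfolding prod.empty by (rule poly_space_const)
next
  case (insert p P)
  then have "(\<lambda>y. f p y * (\<Prod>p\<in>P. f p y)) \<in> poly_space V (1 + card P)"
    by (intro poly_space_mult) auto
  with insert show ?case by simp
qed

text \<open>For each zero pattern \<open>Z\<close>, attained at a point \<open>y Z\<close>, let \<open>g Z\<close> be the product of the \<open>f p\<close> that do not
  vanish there. Then \<open>g Z\<close> is nonzero at \<open>y W\<close> iff \<open>W \<subseteq> Z\<close>. Evaluating a linear relation between the
  \<open>g Z\<close> at \<open>y W\<close>, for a maximal \<open>W\<close> with nonzero coefficient, shows that the \<open>g Z\<close> are linearly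
  independent, so there are no more of them than monomials of the relevant degrees.\<close>

theorem zero_pattern_bound:
  fixes f :: "'p \<Rightarrow> ('v \<Rightarrow> 'a::field) \<Rightarrow> 'a"
  assumes V: "finite V" and P: "finite P" and f: "\<And>p. p \<in> P \<Longrightarrow> f p \<in> poly_space V 1"
  shows "card {Z. \<exists>y. Z = {p\<in>P. f p y = 0}} \<le> (card P + 1) ^ card V"
proof -
  define \<Z> where "\<Z> = {Z. \<exists>y. Z = {p\<in>P. f p y = 0}}"
  have fin: "finite \<Z>" by (rule finite_subset[of _ "Pow P"]) (use P in \<open>auto simp: \<Z>_def\<close>)
  have "\<forall>Z\<in>\<Z>. \<exists>y. Z = {p\<in>P. f p y = 0}" by (auto simp: \<Z>_def)
  then obtain y where y: "\<And>Z. Z \<in> \<Z> \<Longrightarrow> Z = {p\<in>P. f p (y Z) = 0}" by metis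
  define g where "g Z = (\<lambda>y. \<Prod>p\<in>P - Z. f p y)" for Z
  have g: "g Z (y W) \<noteq> 0 \<longleftrightarrow> W \<subseteq> Z" if "W \<in> \<Z>" "Z \<in> \<Z>" for Z W
  proof -
    have "g Z (y W) \<noteq> 0 \<longleftrightarrow> (\<forall>p\<in>P - Z. f p (y W) \<noteq> 0)" using P by (auto simp: g_def)
    also have "\<dots> \<longleftrightarrow> W \<subseteq> Z" using y[OF that(1)] by blast
    finally show ?thesis .
  qed
  have inj: "inj_on g \<Z>"
  proof (rule inj_onI)
    have sub: "W \<subseteq> Z" if "W \<in> \<Z>" "Z \<in> \<Z>" "g Z = g W" for Z W
      using g[of W W] g[of W Z] that by simp
    fix Z W assume "Z \<in> \<Z>" "W \<in> \<Z>" "g Z = g W"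
    then show "Z = W" using sub[of W Z] sub[of Z W] by simp
  qed
  have zero: "\<forall>Z\<in>\<Z>. c (g Z) = 0" if c: "(\<Sum>h\<in>g ` \<Z>. (\<lambda>y. c h * h y)) = 0" for c
  proof (rule ccontr)
    assume nz: "\<not> (\<forall>Z\<in>\<Z>. c (g Z) = 0)"
    let ?N = "{Z\<in>\<Z>. c (g Z) \<noteq> 0}"
    have "finite ?N" "?N \<noteq> {}" using fin nz by auto
    from finite_has_maximal[OF this]
    obtain W where W: "W \<in> ?N" "\<And>Z. Z \<in> ?N \<Longrightarrow> W \<subseteq> Z \<Longrightarrow> Z = W"
      by blast
    have "0 = (\<Sum>h\<in>g ` \<Z>. (\<lambda>y. c h * h y)) (y W)" using c by simp
    also have "\<dots> = (\<Sum>h\<in>g ` \<Z>. c h * h (y W))"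
    proof -
      have "(\<Sum>h\<in>H. (\<lambda>y. c h * h y)) x = (\<Sum>h\<in>H. c h * h x)" if "finite H" for H x
        using that by (induction H rule: finite_induct) auto
      then show ?thesis using fin by simp
    qed
    also have "\<dots> = (\<Sum>Z\<in>\<Z>. c (g Z) * g Z (y W))" using inj by (simp add: sum.reindex)
    also have "\<dots> = (\<Sum>Z\<in>{W}. c (g Z) * g Z (y W))"
    proof (rule sum.mono_neutral_right[OF fin])
      show "\<forall>Z\<in>\<Z> - {W}. c (g Z) * g Z (y W) = 0" using W g[of W] by auto
    qed (use W in auto)
    also have "\<dots> \<noteq> 0" using W g[of W W] by auto
    finally show False by simp
  qed
  have ind: "func.independent (g ` \<Z>)"
    by (rule func.independent_if_scalars_zero) (use fin zero in auto)
  have "g ` \<Z> \<subseteq> poly_space V (card P)"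
  proof clarify
    fix Z assume "Z \<in> \<Z>"
    have "g Z \<in> poly_space V (card (P - Z))"
      unfolding g_def using P f by (intro poly_space_prod) auto
    then show "g Z \<in> poly_space V (card P)"
      using poly_space_mono[of "card (P - Z)" "card P" V] P by (auto simp: card_mono)
  qed
  then have "card (g ` \<Z>) \<le> card (monomial V ` (V \<rightarrow>\<^sub>E {..card P}) :: (('v \<Rightarrow> 'a) \<Rightarrow> 'a) set)"
    using func.independent_span_bound[OF _ ind] V by (simp add: finite_PiE)
  also have "\<dots> \<le> card (V \<rightarrow>\<^sub>E {..card P})" using V by (intro card_image_le finite_PiE) auto
  also have "\<dots> = (card P + 1) ^ card V" using V by (simp add: card_PiE)
  finally show ?thesis using inj by (simp add: card_image \<Z>_def)
qed

section \<open>Uniformly random sets of positions\<close>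

text \<open>The left-hand side is the sum of the products over repetition-free sequences of length \<open>m\<close>, the
  right-hand side is the sum over all sequences.\<close>

lemma sum_prod_subsets_le:
  fixes w :: "'a \<Rightarrow> real"
  assumes P: "finite P" and w: "\<And>p. p \<in> P \<Longrightarrow> w p \<ge> 0"
  shows "fact m * (\<Sum>\<Omega> | \<Omega> \<subseteq> P \<and> card \<Omega> = m. \<Prod>p\<in>\<Omega>. w p) \<le> (\<Sum>p\<in>P. w p) ^ m"
proof (induction m)
  case 0
  have "{\<Omega>. \<Omega> \<subseteq> P \<and> card \<Omega> = 0} = {{}}" using P by (auto dest: finite_subset)
  then show ?case by simp
next
  case (Suc m)
  let ?F = "\<lambda>m. {\<Omega>. \<Omega> \<subseteq> P \<and> card \<Omega> = m}"
  have fin: "finite (?F i)" for i using P by (auto intro: finite_subset[of _ "Pow P"])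
  have finF: "finite \<Omega>" if "\<Omega> \<in> ?F i" for \<Omega> i using that P finite_subset by blast
  have "real (Suc m) * (\<Sum>\<Omega>\<in>?F (Suc m). \<Prod>p\<in>\<Omega>. w p) = (\<Sum>\<Omega>\<in>?F (Suc m). \<Sum>q\<in>\<Omega>. \<Prod>p\<in>\<Omega>. w p)"
    by (simp add: sum_distrib_left)
  also have "\<dots> = (\<Sum>(\<Omega>, q)\<in>Sigma (?F (Suc m)) (\<lambda>\<Omega>. \<Omega>). \<Prod>p\<in>\<Omega>. w p)"
    by (rule sum.Sigma[OF fin]) (use finF in blast)
  also have "\<dots> = (\<Sum>(\<Omega>, q)\<in>Sigma (?F m) (\<lambda>\<Omega>. P - \<Omega>). w q * (\<Prod>p\<in>\<Omega>. w p))"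
  proof (rule sum.reindex_bij_witness[where i = "\<lambda>(\<Omega>, q). (insert q \<Omega>, q)" and j = "\<lambda>(\<Omega>, q). (\<Omega> - {q}, q)"])
    fix a assume a: "a \<in> Sigma (?F (Suc m)) (\<lambda>\<Omega>. \<Omega>)"
    obtain \<Omega> q where aq: "a = (\<Omega>, q)" by (cases a)
    then have \<Omega>: "\<Omega> \<in> ?F (Suc m)" "q \<in> \<Omega>" using a by auto
    have f: "finite \<Omega>" using finF[OF \<Omega>(1)] .
    show "(case case a of (\<Omega>, q) \<Rightarrow> (\<Omega> - {q}, q) of (\<Omega>, q) \<Rightarrow> (insert q \<Omega>, q)) = a"
      using \<Omega> aq by auto
    show "(case a of (\<Omega>, q) \<Rightarrow> (\<Omega> - {q}, q)) \<in> Sigma (?F m) (\<lambda>\<Omega>. P - \<Omega>)"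
      using \<Omega> f aq by auto
    show "(case case a of (\<Omega>, q) \<Rightarrow> (\<Omega> - {q}, q) of (\<Omega>, q) \<Rightarrow> w q * (\<Prod>p\<in>\<Omega>. w p)) = (case a of (\<Omega>, q) \<Rightarrow> \<Prod>p\<in>\<Omega>. w p)"
      using \<Omega> f aq by (simp add: prod.remove[of \<Omega> q])
  next
    fix b assume b: "b \<in> Sigma (?F m) (\<lambda>\<Omega>. P - \<Omega>)"
    obtain \<Omega> q where bq: "b = (\<Omega>, q)" by (cases b)
    then have \<Omega>: "\<Omega> \<in> ?F m" "q \<in> P - \<Omega>" using b by auto
    have f: "finite \<Omega>" using finF[OF \<Omega>(1)] .
    show "(case case b of (\<Omega>, q) \<Rightarrow> (insert q \<Omega>, q) of (\<Omega>, q) \<Rightarrow> (\<Omega> - {q}, q)) = b"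
      using \<Omega> bq by auto
    show "(case b of (\<Omega>, q) \<Rightarrow> (insert q \<Omega>, q)) \<in> Sigma (?F (Suc m)) (\<lambda>\<Omega>. \<Omega>)"
      using \<Omega> f bq by auto
  qed
  also have "\<dots> = (\<Sum>\<Omega>\<in>?F m. (\<Prod>p\<in>\<Omega>. w p) * (\<Sum>q\<in>P - \<Omega>. w q))"
    using fin P by (subst sum.Sigma[symmetric]) (auto simp: sum_distrib_left mult.commute)
  also have "\<dots> \<le> (\<Sum>\<Omega>\<in>?F m. (\<Prod>p\<in>\<Omega>. w p) * (\<Sum>q\<in>P. w q))"
    using P w by (intro sum_mono mult_left_mono sum_mono2 prod_nonneg) auto
  also have "\<dots> = (\<Sum>\<Omega>\<in>?F m. \<Prod>p\<in>\<Omega>. w p) * (\<Sum>q\<in>P. w q)"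
    by (simp add: sum_distrib_right)
  finally have step: "real (Suc m) * (\<Sum>\<Omega>\<in>?F (Suc m). \<Prod>p\<in>\<Omega>. w p)
      \<le> (\<Sum>\<Omega>\<in>?F m. \<Prod>p\<in>\<Omega>. w p) * (\<Sum>q\<in>P. w q)" .
  have "fact (Suc m) * (\<Sum>\<Omega>\<in>?F (Suc m). \<Prod>p\<in>\<Omega>. w p)
      = fact m * (real (Suc m) * (\<Sum>\<Omega>\<in>?F (Suc m). \<Prod>p\<in>\<Omega>. w p))"
    by (simp add: mult_ac)
  also have "\<dots> \<le> fact m * ((\<Sum>\<Omega>\<in>?F m. \<Prod>p\<in>\<Omega>. w p) * (\<Sum>q\<in>P. w q))"
    by (rule mult_left_mono[OF step]) simp
  also have "\<dots> = (fact m * (\<Sum>\<Omega>\<in>?F m. \<Prod>p\<in>\<Omega>. w p)) * (\<Sum>q\<in>P. w q)" by (simp add: mult_ac)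
  also have "\<dots> \<le> (\<Sum>p\<in>P. w p) ^ m * (\<Sum>q\<in>P. w q)"
    using Suc.IH w by (intro mult_right_mono sum_nonneg) auto
  finally show ?case by (simp add: mult.commute)
qed

text \<open>A sequence of \<open>m\<close> elements out of \<open>N\<close> has no repetition with probability at least
  \<open>(1 - m / N) ^ m \<ge> 1 - m\<^sup>2 / N\<close>.\<close>

lemma power_le_binomial:
  assumes "2 * m\<^sup>2 \<le> N"
  shows "real N ^ m \<le> 2 * (fact m * real (N choose m))"
proof (cases "m = 0")
  case False
  have "m \<le> m\<^sup>2" by (simp add: power2_eq_square)
  then have mN: "m \<le> N" and N: "N > 0" using assms False by auto
  have "1 / 2 \<le> 1 + real m * (- (real m / real N))"
  proof -
    have "real (2 * m\<^sup>2) \<le> real N" using assms by (rule of_nat_mono)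
    then show ?thesis using N by (simp add: field_simps power2_eq_square)
  qed
  also have "\<dots> \<le> (1 + (- (real m / real N))) ^ m"
    by (rule Bernoulli_inequality) (use mN N in simp)
  finally have "real N ^ m * (1 / 2) \<le> real N ^ m * (1 - real m / real N) ^ m"
    by (intro mult_left_mono) auto
  also have "\<dots> = (real N - real m) ^ m"
    using N by (simp add: right_diff_distrib flip: power_mult_distrib)
  also have "\<dots> = (\<Prod>i=0..<m. real N - real m)" by simp
  also have "\<dots> \<le> (\<Prod>i=0..<m. real N - real i)"
    using mN by (intro prod_mono) auto
  also have "\<dots> = fact m * (real N gchoose m)" by (simp add: gbinomial_mult_fact)
  also have "\<dots> = fact m * real (N choose m)" by (simp add: binomial_gbinomial)
  finally show ?thesis by simp
qed simp

text \<open>An exponential-moment bound for sampling without replacement, which costs only a factor \<open>2\<close> compared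
  with independent samples as long as repetitions are unlikely: an event on which a product of weights
  is at least \<open>1 / C\<close> has probability at most \<open>2 * C\<close> times the \<open>m\<close>-th power of the average weight.\<close>

lemma prob_random_positions_le:
  fixes w :: "(nat \<Rightarrow> nat) \<Rightarrow> real"
  assumes m: "2 * m\<^sup>2 \<le> n ^ k" and n: "n > 0"
    and w: "\<And>p. p \<in> positions k n \<Longrightarrow> w p \<ge> 0" and C: "C \<ge> 0"
    and E: "\<And>\<Omega>. \<Omega> \<subseteq> positions k n \<Longrightarrow> card \<Omega> = m \<Longrightarrow> \<Omega> \<in> E \<Longrightarrow> 1 \<le> C * (\<Prod>p\<in>\<Omega>. w p)"
  shows "measure_pmf.prob (random_positions k n m) E \<le> 2 * C * ((\<Sum>p\<in>positions k n. w p) / real n ^ k) ^ m"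
proof -
  let ?F = "{\<Omega>. \<Omega> \<subseteq> positions k n \<and> card \<Omega> = m}"
  have fin: "finite ?F" by (auto intro: finite_subset[of _ "Pow (positions k n)"])
  have cardF: "card ?F = (n ^ k choose m)" by (simp add: n_subsets card_positions)
  have "m \<le> m\<^sup>2" by (simp add: power2_eq_square)
  then have pos: "(n ^ k choose m) > 0" using m by (intro zero_less_binomial) linarith
  then have ne: "?F \<noteq> {}" using cardF by (metis card.empty less_irrefl)
  have "real (card (?F \<inter> E)) = (\<Sum>\<Omega>\<in>?F \<inter> E. 1)" by simp
  also have "\<dots> \<le> (\<Sum>\<Omega>\<in>?F \<inter> E. C * (\<Prod>p\<in>\<Omega>. w p))" using E by (intro sum_mono) auto
  also have "\<dots> \<le> (\<Sum>\<Omega>\<in>?F. C * (\<Prod>p\<in>\<Omega>. w p))"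
    using fin C w by (intro sum_mono2 mult_nonneg_nonneg prod_nonneg) auto
  also have "\<dots> = C * (\<Sum>\<Omega>\<in>?F. \<Prod>p\<in>\<Omega>. w p)" by (simp add: sum_distrib_left)
  finally have "fact m * real (card (?F \<inter> E)) \<le> fact m * (C * (\<Sum>\<Omega>\<in>?F. \<Prod>p\<in>\<Omega>. w p))"
    by (intro mult_left_mono) auto
  also have "\<dots> = C * (fact m * (\<Sum>\<Omega>\<in>?F. \<Prod>p\<in>\<Omega>. w p))" by simp
  also have "\<dots> \<le> C * (\<Sum>p\<in>positions k n. w p) ^ m"
    using C w by (intro mult_left_mono sum_prod_subsets_le) auto
  finally have 1: "fact m * real (card (?F \<inter> E)) \<le> C * (\<Sum>p\<in>positions k n. w p) ^ m" .
  have 2: "(real n ^ k) ^ m \<le> 2 * (fact m * real (n ^ k choose m))"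
    using power_le_binomial[OF m] by simp
  have "measure_pmf.prob (random_positions k n m) E = real (card (?F \<inter> E)) / real (n ^ k choose m)"
    unfolding random_positions_def using measure_pmf_of_set[OF ne fin] by (simp add: cardF)
  also have "\<dots> = (fact m * real (card (?F \<inter> E))) / (fact m * real (n ^ k choose m))" by simp
  also have "\<dots> \<le> (C * (\<Sum>p\<in>positions k n. w p) ^ m) / (fact m * real (n ^ k choose m))"
    using 1 by (rule divide_right_mono) simp
  also have "\<dots> \<le> (C * (\<Sum>p\<in>positions k n. w p) ^ m) / ((real n ^ k) ^ m / 2)"
    using 2 n pos C w by (intro divide_left_mono mult_nonneg_nonneg zero_le_power sum_nonneg) auto
  finally show ?thesis by (simp add: power_divide mult_ac)
qed

lemma prob_subset_le:
  assumes "2 * m\<^sup>2 \<le> n ^ k" "n > 0" "Z \<subseteq> positions k n"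
  shows "measure_pmf.prob (random_positions k n m) {\<Omega>. \<Omega> \<subseteq> Z} \<le> 2 * (card Z / real n ^ k) ^ m"
proof -
  have "measure_pmf.prob (random_positions k n m) {\<Omega>. \<Omega> \<subseteq> Z}
      \<le> 2 * 1 * ((\<Sum>p\<in>positions k n. if p \<in> Z then 1 else 0) / real n ^ k) ^ m"
    by (rule prob_random_positions_le[OF assms(1,2)]) (auto intro!: prod_ge_1)
  also have "(\<Sum>p\<in>positions k n. if p \<in> Z then 1 else (0::real)) = card Z"
    using assms(3) by (simp add: sum.If_cases Int_absorb1)
  finally show ?thesis by simp
qed

section \<open>Agreement sets are dense\<close>

lemma cp_entry_poly_space:
  assumes p: "p \<in> positions k n"
  shows "(\<lambda>y. cp_tensor k n d (\<lambda>i j l. y (i, j, l)) p - (c::'a::field_char_0))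
    \<in> poly_space ({..<d} \<times> {..<k} \<times> {..<n}) 1"
proof -
  let ?V = "{..<d} \<times> {..<k} \<times> {..<n}"
  have "(\<lambda>y. \<Prod>j<k. y (i, j, p j)) \<in> (poly_space ?V 1 :: ((nat \<times> nat \<times> nat \<Rightarrow> 'a) \<Rightarrow> 'a) set)" if i: "i < d" for i
  proof -
    let ?e = "\<lambda>v\<in>?V. if v \<in> (\<lambda>j. (i, j, p j)) ` {..<k} then 1 else 0 :: nat"
    have sub: "(\<lambda>j. (i, j, p j)) ` {..<k} \<subseteq> ?V" using i p by (auto intro: positions_less)
    have eq: "(\<lambda>y. \<Prod>j<k. y (i, j, p j)) = (monomial ?V ?e :: (nat \<times> nat \<times> nat \<Rightarrow> 'a) \<Rightarrow> 'a)"
    proof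
      fix y :: "nat \<times> nat \<times> nat \<Rightarrow> 'a"
      have "monomial ?V ?e y = (\<Prod>v\<in>?V. if v \<in> (\<lambda>j. (i, j, p j)) ` {..<k} then y v else 1)"
        unfolding monomial_def by (intro prod.cong refl) auto
      also have "\<dots> = (\<Prod>v\<in>(\<lambda>j. (i, j, p j)) ` {..<k}. y v)"
        using sub by (subst prod.inter_restrict[symmetric]) (auto simp: Int_absorb1)
      also have "\<dots> = (\<Prod>j<k. y (i, j, p j))" by (subst prod.reindex) (auto simp: inj_on_def)
      finally show "(\<Prod>j<k. y (i, j, p j)) = monomial ?V ?e y" by simp
    qed
    have "?e \<in> ?V \<rightarrow>\<^sub>E {..1}" by auto
    then show ?thesis unfolding eq by (intro func.span_base imageI)
  qed
  then have "(\<Sum>i<d. (\<lambda>y. \<Prod>j<k. y (i, j, p j))) - (\<lambda>y. c) \<in> poly_space ?V 1"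
    by (intro func.span_diff func.span_sum poly_space_const) auto
  also have "(\<Sum>i<d. (\<lambda>y. \<Prod>j<k. y (i, j, p j))) - (\<lambda>y. c)
      = (\<lambda>y :: nat \<times> nat \<times> nat \<Rightarrow> 'a. cp_tensor k n d (\<lambda>i j l. y (i, j, l)) p - c)"
  proof -
    have "(\<Sum>i\<in>I. (\<lambda>y. \<Prod>j<k. y (i, j, p j))) z = (\<Sum>i\<in>I. \<Prod>j<k. z (i, j, p j))"
      for I and z :: "nat \<times> nat \<times> nat \<Rightarrow> 'a"
      by (induction I rule: infinite_finite_induct) auto
    then show ?thesis using p by (auto simp: fun_eq_iff cp_tensor_def)
  qed
  finally show ?thesis .
qed

lemma card_agreement_sets_le:
  fixes T :: "(nat \<Rightarrow> nat) \<Rightarrow> 'a::field_char_0"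
  shows "finite {Z. \<exists>y. Z = {p \<in> positions k n. cp_tensor k n d y p = T p}}"
    and "card {Z. \<exists>y. Z = {p \<in> positions k n. cp_tensor k n d y p = T p}} \<le> (n ^ k + 1) ^ (d * (k * n))"
proof -
  let ?V = "{..<d} \<times> {..<k} \<times> {..<n}"
  have "card {Z. \<exists>y. Z = {p \<in> positions k n. cp_tensor k n d (\<lambda>i j l. y (i, j, l)) p - T p = 0}}
      \<le> (card (positions k n) + 1) ^ card ?V"
    by (rule zero_pattern_bound) (auto intro: cp_entry_poly_space[unfolded One_nat_def])
  moreover have "{Z. \<exists>y. Z = {p \<in> positions k n. cp_tensor k n d (\<lambda>i j l. y (i, j, l)) p - T p = 0}}
      = {Z. \<exists>y. Z = {p \<in> positions k n. cp_tensor k n d y p = T p}}" (is "?L = ?R")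
  proof
    show "?R \<subseteq> ?L"
    proof clarify
      fix y
      show "\<exists>y'. {p \<in> positions k n. cp_tensor k n d y p = T p}
          = {p \<in> positions k n. cp_tensor k n d (\<lambda>i j l. y' (i, j, l)) p - T p = 0}"
        by (rule exI[of _ "\<lambda>(i, j, l). y i j l"]) simp
    qed
  qed auto
  ultimately show "card {Z. \<exists>y. Z = {p \<in> positions k n. cp_tensor k n d y p = T p}} \<le> (n ^ k + 1) ^ (d * (k * n))"
    by (simp add: card_positions)
  show "finite {Z. \<exists>y. Z = {p \<in> positions k n. cp_tensor k n d y p = T p}}"
    by (rule finite_subset[of _ "Pow (positions k n)"]) auto
qed

lemma prob_sparse_agreement_le:
  fixes T :: "(nat \<Rightarrow> nat) \<Rightarrow> 'a::field_char_0"
  assumes m: "2 * m\<^sup>2 \<le> n ^ k" and n: "n > 0" and \<epsilon>: "\<epsilon> > 0"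
  shows "measure_pmf.prob (random_positions k n m)
      {\<Omega>. \<Omega> \<subseteq> positions k n \<and> (\<exists>y. (\<forall>p\<in>\<Omega>. cp_tensor k n d y p = T p) \<and>
        card {p \<in> positions k n. cp_tensor k n d y p = T p} < \<epsilon> * real n ^ k)}
    \<le> real ((n ^ k + 1) ^ (d * (k * n))) * (2 * \<epsilon> ^ m)"
proof -
  let ?A = "{Z. \<exists>y. Z = {p \<in> positions k n. cp_tensor k n d y p = T p}}"
  let ?B = "{Z \<in> ?A. card Z < \<epsilon> * real n ^ k}"
  let ?P = "measure_pmf.prob (random_positions k n m)"
  have fin: "finite ?B" using card_agreement_sets_le(1)[of k n d T] by (rule rev_finite_subset) auto
  have "?P {\<Omega>. \<Omega> \<subseteq> positions k n \<and> (\<exists>y. (\<forall>p\<in>\<Omega>. cp_tensor k n d y p = T p) \<and>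
        card {p \<in> positions k n. cp_tensor k n d y p = T p} < \<epsilon> * real n ^ k)}
      \<le> ?P (\<Union>Z\<in>?B. {\<Omega>. \<Omega> \<subseteq> Z})"
    by (rule measure_pmf.finite_measure_mono) (blast, simp)
  also have "\<dots> \<le> (\<Sum>Z\<in>?B. ?P {\<Omega>. \<Omega> \<subseteq> Z})"
    by (rule measure_UNION_le) (use fin in auto)
  also have "\<dots> \<le> (\<Sum>Z\<in>?B. 2 * \<epsilon> ^ m)"
  proof (rule sum_mono)
    fix Z assume Z: "Z \<in> ?B"
    then have "Z \<subseteq> positions k n" by auto
    then have "?P {\<Omega>. \<Omega> \<subseteq> Z} \<le> 2 * (card Z / real n ^ k) ^ m"
      by (rule prob_subset_le[OF m n])
    also have "\<dots> \<le> 2 * \<epsilon> ^ m"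
      using Z n by (intro mult_left_mono power_mono) (auto simp: field_simps)
    finally show "?P {\<Omega>. \<Omega> \<subseteq> Z} \<le> 2 * \<epsilon> ^ m" .
  qed
  also have "\<dots> = real (card ?B) * (2 * \<epsilon> ^ m)" by simp
  also have "\<dots> \<le> real ((n ^ k + 1) ^ (d * (k * n))) * (2 * \<epsilon> ^ m)"
  proof (intro mult_right_mono of_nat_mono)
    have "card ?B \<le> card ?A" using card_agreement_sets_le(1)[of k n d T] by (intro card_mono) auto
    then show "card ?B \<le> (n ^ k + 1) ^ (d * (k * n))"
      using card_agreement_sets_le(2)[of k n d T] by (rule order_trans)
  qed (use \<epsilon> in simp)
  finally show ?thesis .
qed

section \<open>Random sets are expanding\<close>

lemma star_unique:
  assumes "p \<in> star k n B j l" "p \<in> star k n B j' l'" "(j, l) \<notin> B" "(j', l') \<notin> B" "j < k" "j' < k"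
  shows "(j, l) = (j', l')"
  using assms by (cases "j = j'") (auto simp: star_def)

text \<open>The stars of different vertices outside \<open>B\<close> are disjoint, so the event leaves at most \<open>d - 1\<close> observed
  positions per vertex in their union. Giving weight \<open>x\<close> to that union and weight \<open>1\<close> elsewhere yields
  the bound for every \<open>x\<close>; values of the order of \<open>n / m\<close> make it small. The number \<open>\<rho>\<close> bounds the
  size of a star relative to a full slice.\<close>

lemma prob_stuck_le:
  fixes x \<rho> :: real
  assumes m: "2 * m\<^sup>2 \<le> n ^ k" and n: "n > 0" and k: "k > 0" and d: "d \<ge> 1" and B: "B \<subseteq> {..<k} \<times> {..<n}"
    and x: "0 < x" "x \<le> 1"
    and \<rho>: "\<And>j. j < k \<Longrightarrow> \<rho> * real n ^ (k - 1) \<le> real (\<Prod>i\<in>{..<k} - {j}. card (slice B i))"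
  shows "measure_pmf.prob (random_positions k n m)
      {\<Omega>. \<forall>(j, l)\<in>{..<k} \<times> {..<n} - B. card (\<Omega> \<inter> star k n B j l) < d}
    \<le> 2 * ((1 / x) ^ (d - 1) * exp (- ((1 - x) * \<rho> * m / n))) ^ card ({..<k} \<times> {..<n} - B)"
proof -
  define U where "U = {..<k} \<times> {..<n} - B"
  define st where "st = (\<lambda>(j, l). star k n B j l)"
  define F where "F = (\<Union>v\<in>U. st v)"
  define w where "w p = (if p \<in> F then x else 1)" for p
  let ?u = "card U" and ?P = "positions k n"
  have finU: "finite U" by (simp add: U_def)
  have st: "st v \<subseteq> ?P" for v by (auto simp: st_def star_def split: prod.splits)
  have finst: "finite (st v)" for v using st by (rule finite_subset) simp
  have FP: "F \<subseteq> ?P" using st by (auto simp: F_def)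
  have cardF: "card F = (\<Sum>v\<in>U. card (st v))"
    unfolding F_def
  proof (rule card_UN_disjoint[OF finU])
    show "\<forall>v\<in>U. \<forall>v'\<in>U. v \<noteq> v' \<longrightarrow> st v \<inter> st v' = {}"
    proof (intro ballI impI equals0I)
      fix v v' p assume v: "v \<in> U" "v' \<in> U" "v \<noteq> v'" and p: "p \<in> st v \<inter> st v'"
      obtain j l j' l' where [simp]: "v = (j, l)" "v' = (j', l')" by (cases v, cases v')
      show False using v p star_unique[of p k n B j l j' l'] by (simp add: U_def st_def)
    qed
  qed (use finst in auto)
  have "?u * (\<rho> * real n ^ (k - 1)) = (\<Sum>v\<in>U. \<rho> * real n ^ (k - 1))" by simp
  also have "\<dots> \<le> (\<Sum>v\<in>U. real (card (st v)))"
  proof (rule sum_mono)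
    fix v assume "v \<in> U"
    then obtain j l where v: "v = (j, l)" "j < k" "l < n" by (auto simp: U_def)
    then show "\<rho> * real n ^ (k - 1) \<le> real (card (st v))"
      using \<rho>[OF v(2)] card_star[OF B v(2,3)] by (simp add: st_def)
  qed
  finally have Fge: "?u * (\<rho> * real n ^ (k - 1)) \<le> real (card F)" by (simp add: cardF)
  have nk: "real n ^ k = real n * real n ^ (k - 1)" using k by (cases k) auto
  have "(\<Sum>p\<in>?P. w p) = (\<Sum>p\<in>?P. 1 - (1 - x) * (if p \<in> F then 1 else 0))"
    by (intro sum.cong) (auto simp: w_def)
  also have "\<dots> = real n ^ k - (1 - x) * real (card F)"
    using FP by (simp add: sum_subtractf card_positions sum.If_cases Int_absorb1 flip: sum_distrib_left)
  finally have sumw: "(\<Sum>p\<in>?P. w p) = real n ^ k - (1 - x) * real (card F)" .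
  have "(\<Sum>p\<in>?P. w p) / real n ^ k = 1 - (1 - x) * (card F / real n ^ k)"
    using n by (simp add: sumw field_simps)
  also have "\<dots> \<le> 1 - (1 - x) * (?u * \<rho> / n)"
  proof -
    have "?u * \<rho> / n \<le> card F / real n ^ k"
      using Fge n by (simp add: nk field_simps)
    then show ?thesis using x by (intro diff_left_mono mult_left_mono) auto
  qed
  also have "\<dots> \<le> exp (- ((1 - x) * (?u * \<rho> / n)))"
    using exp_ge_add_one_self[of "- ((1 - x) * (?u * \<rho> / n))"] by simp
  finally have base: "(\<Sum>p\<in>?P. w p) / real n ^ k \<le> exp (- ((1 - x) * (?u * \<rho> / n)))" .
  have "measure_pmf.prob (random_positions k n m) {\<Omega>. \<forall>(j, l)\<in>U. card (\<Omega> \<inter> star k n B j l) < d}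
      \<le> 2 * (1 / x) ^ ((d - 1) * ?u) * ((\<Sum>p\<in>?P. w p) / real n ^ k) ^ m"
  proof (rule prob_random_positions_le[OF m n])
    fix \<Omega> assume \<Omega>: "\<Omega> \<subseteq> ?P" "\<Omega> \<in> {\<Omega>. \<forall>(j, l)\<in>U. card (\<Omega> \<inter> star k n B j l) < d}"
    have fin: "finite \<Omega>" using \<Omega>(1) by (rule finite_subset) simp
    have "\<Omega> \<inter> F = (\<Union>v\<in>U. \<Omega> \<inter> st v)" by (auto simp: F_def)
    then have "card (\<Omega> \<inter> F) \<le> (\<Sum>v\<in>U. card (\<Omega> \<inter> st v))" using card_UN_le[OF finU] by metis
    also have "\<dots> \<le> (\<Sum>v\<in>U. d - 1)"
      using \<Omega>(2) d by (intro sum_mono) (fastforce simp: st_def)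
    finally have "card (\<Omega> \<inter> F) \<le> (d - 1) * ?u" by (simp add: mult.commute)
    then have "x ^ ((d - 1) * ?u) \<le> x ^ card (\<Omega> \<inter> F)" using x by (intro power_decreasing) auto
    also have "\<dots> = (\<Prod>p\<in>\<Omega>. w p)"
      using fin by (simp add: w_def prod.If_cases Int_commute)
    finally show "1 \<le> (1 / x) ^ ((d - 1) * ?u) * (\<Prod>p\<in>\<Omega>. w p)"
      using x by (simp add: power_divide field_simps)
  qed (use x in \<open>auto simp: w_def\<close>)
  also have "\<dots> \<le> 2 * (1 / x) ^ ((d - 1) * ?u) * exp (- ((1 - x) * (?u * \<rho> / n))) ^ m"
    using base x by (intro mult_left_mono power_mono divide_nonneg_nonneg sum_nonneg) (auto simp: w_def)
  also have "exp (- ((1 - x) * (?u * \<rho> / n))) ^ m = exp (- ((1 - x) * \<rho> * m / n)) ^ ?u"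
    by (simp add: mult_ac flip: exp_of_nat_mult)
  also have "2 * (1 / x) ^ ((d - 1) * ?u) * exp (- ((1 - x) * \<rho> * m / n)) ^ ?u
      = 2 * ((1 / x) ^ (d - 1) * exp (- ((1 - x) * \<rho> * m / n))) ^ ?u"
    by (simp only: power_mult power_mult_distrib mult.assoc)
  finally show ?thesis by (simp add: U_def)
qed

text \<open>Few missing vertices shrink the stars only slightly.\<close>

lemma prod_slices_ge:
  assumes B: "B \<subseteq> {..<k} \<times> {..<n}" and n: "n > 0" and j: "j < k"
    and small: "real (card ({..<k} \<times> {..<n} - B)) \<le> \<delta> * n"
  shows "(1 - \<delta>) * real n ^ (k - 1) \<le> real (\<Prod>i\<in>{..<k} - {j}. card (slice B i))"
proof -
  let ?U = "{..<k} \<times> {..<n} - B"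
  have slice: "real (card (slice B i)) = n * (1 - card (slice ?U i) / n)" if "i < k" for i
  proof -
    have "slice B i \<union> slice ?U i = {..<n}" "slice B i \<inter> slice ?U i = {}" using B that by auto
    then have "card (slice B i) + card (slice ?U i) = n"
      using card_Un_disjoint[of "slice B i" "slice ?U i"] B by (metis card_lessThan finite_Un finite_lessThan)
    then have "real (card (slice B i)) = n - real (card (slice ?U i))" by linarith
    then show ?thesis using n by (simp add: right_diff_distrib)
  qed
  have le1: "real (card (slice ?U i)) / n \<le> 1" if "i < k" for i
  proof -
    have "card (slice ?U i) \<le> card {..<n}" by (intro card_mono) auto
    then show ?thesis using n by simp
  qed
  have "(\<Sum>i<k. card (slice ?U i)) = card ?U"
  proof -
    have "?U = Sigma {..<k} (\<lambda>i. slice ?U i)" by auto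
    moreover have "card (Sigma {..<k} (\<lambda>i. slice ?U i)) = (\<Sum>i<k. card (slice ?U i))"
      by (rule card_SigmaI) (auto intro: finite_slice[of _ k n])
    ultimately show ?thesis by simp
  qed
  then have "(\<Sum>i<k. real (card (slice ?U i)) / n) = real (card ?U) / n"
    by (simp flip: sum_divide_distrib of_nat_sum)
  also have "\<dots> \<le> \<delta>" using small n by (simp add: field_simps)
  finally have sum: "(\<Sum>i<k. real (card (slice ?U i)) / n) \<le> \<delta>" .
  have "(\<Sum>i\<in>{..<k} - {j}. real (card (slice ?U i)) / n) \<le> (\<Sum>i<k. real (card (slice ?U i)) / n)"
    by (intro sum_mono2) auto
  then have "1 - \<delta> \<le> 1 - (\<Sum>i\<in>{..<k} - {j}. real (card (slice ?U i)) / n)" using sum by linarith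
  also have "\<dots> \<le> (\<Prod>i\<in>{..<k} - {j}. 1 - real (card (slice ?U i)) / n)"
    by (rule Weierstrass_prod_ineq) (use le1 in auto)
  finally have "(1 - \<delta>) * real n ^ (k - 1) \<le> (\<Prod>i\<in>{..<k} - {j}. 1 - real (card (slice ?U i)) / n) * real n ^ (k - 1)"
    by (intro mult_right_mono) auto
  also have "\<dots> = (\<Prod>i\<in>{..<k} - {j}. real n * (1 - real (card (slice ?U i)) / n))"
    using j by (simp add: prod.distrib)
  also have "\<dots> = (\<Prod>i\<in>{..<k} - {j}. real (card (slice B i)))"
    by (intro prod.cong refl) (simp add: slice)
  finally show ?thesis by simp
qed

lemma sum_power_card_subsets:
  fixes z :: "'a::comm_semiring_1"
  assumes "finite V"
  shows "(\<Sum>U\<in>Pow V. z ^ card U) = (1 + z) ^ card V"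
proof -
  have "(\<Prod>v\<in>V. z + 1) = (\<Sum>U\<in>Pow V. (\<Prod>v\<in>U. z) * (\<Prod>v\<in>V - U. 1))"
    by (rule prod_add[OF assms])
  then show ?thesis by (simp add: add.commute)
qed

text \<open>Union bound over the set \<open>U\<close> of missing vertices. If \<open>U\<close> has at most \<open>\<delta> * n\<close> elements, stars are almost
  full and each vertex contributes a factor \<open>z\<close>; the sum of \<open>z ^ card U\<close> over nonempty \<open>U\<close> is
  \<open>(1 + z) ^ (k * n) - 1\<close>. Otherwise stars have relative size \<open>\<beta> ^ (k - 1)\<close> only, and each vertex
  contributes \<open>exp (- 2 * c)\<close>. Half of this exponent pays for the choice of \<open>U\<close>, and the other half,
  collected over more than \<open>\<delta> * n\<close> vertices, makes the total small.\<close>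

lemma prob_not_expanding_le:
  fixes x \<delta> \<beta> c :: real
  assumes m: "2 * m\<^sup>2 \<le> n ^ k" and n: "n > 0" and k: "k > 0" and d: "d \<ge> 1"
    and x: "0 < x" "x \<le> 1" and \<beta>: "\<beta> > 0" and c: "c \<ge> 0"
    and large: "(1 / x) ^ (d - 1) * exp (- ((1 - x) * \<beta> ^ (k - 1) * m / n)) \<le> exp (- (2 * c))"
  defines "z \<equiv> (1 / x) ^ (d - 1) * exp (- ((1 - x) * (1 - \<delta>) * m / n))"
  shows "measure_pmf.prob (random_positions k n m) {\<Omega>. \<not> expanding k n d \<beta> \<Omega>}
    \<le> 2 * (exp (real k * n * z) - 1) + 2 * exp (real k * n * exp (- c) - c * \<delta> * n)"
proof -
  let ?V = "{..<k} \<times> {..<n}" and ?P = "measure_pmf.prob (random_positions k n m)"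
  define stuck where "stuck U = {\<Omega>. \<forall>(j, l)\<in>U. card (\<Omega> \<inter> star k n (?V - U) j l) < d}" for U
  define I where "I = {U \<in> Pow ?V - {{}}. \<forall>j<k. \<beta> * n \<le> card (slice (?V - U) j)}"
  have z0: "z \<ge> 0" using x by (simp add: z_def)
  have finI: "finite I" by (simp add: I_def)
  have cV: "card ?V = k * n" by simp
  have exp_bound: "(1 + s) ^ (k * n) \<le> exp (real k * n * s)" if "s \<ge> 0" for s :: real
  proof -
    have "(1 + s) ^ (k * n) \<le> exp s ^ (k * n)" using that by (intro power_mono exp_ge_add_one_self) auto
    then show ?thesis by (simp flip: exp_of_nat_mult)
  qed
  have "{\<Omega>. \<not> expanding k n d \<beta> \<Omega>} \<subseteq> (\<Union>U\<in>I. stuck U)"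
  proof
    fix \<Omega> assume "\<Omega> \<in> {\<Omega>. \<not> expanding k n d \<beta> \<Omega>}"
    then obtain B where B: "B \<subset> ?V" "\<forall>j<k. \<beta> * n \<le> card (slice B j)"
      "\<not> (\<exists>(j, l)\<in>?V - B. d \<le> card (\<Omega> \<inter> star k n B j l))"
      unfolding expanding_def by blast
    have VVB: "?V - (?V - B) = B" using B(1) by auto
    have "?V - B \<in> I" using B(1,2) unfolding I_def by (auto simp: VVB)
    moreover have "card (\<Omega> \<inter> star k n B j l) < d" if "(j, l) \<in> ?V - B" for j l
      using B(3) bexI[of "\<lambda>(j, l). d \<le> card (\<Omega> \<inter> star k n B j l)" "(j, l)" "?V - B", OF _ that] by auto
    then have "\<Omega> \<in> stuck (?V - B)" unfolding stuck_def VVB by blast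
    ultimately show "\<Omega> \<in> (\<Union>U\<in>I. stuck U)" by blast
  qed
  then have "?P {\<Omega>. \<not> expanding k n d \<beta> \<Omega>} \<le> ?P (\<Union>U\<in>I. stuck U)"
    by (rule measure_pmf.finite_measure_mono) simp
  also have "\<dots> \<le> (\<Sum>U\<in>I. ?P (stuck U))"
    by (rule measure_UNION_le[OF finI]) simp
  also have "\<dots> \<le> (\<Sum>U\<in>I. 2 * z ^ card U + 2 * exp (- (c * \<delta> * n)) * exp (- c) ^ card U)"
  proof (rule sum_mono)
    fix U assume U: "U \<in> I"
    let ?B = "?V - U"
    have VB: "?V - ?B = U" using U by (auto simp: I_def)
    show "?P (stuck U) \<le> 2 * z ^ card U + 2 * exp (- (c * \<delta> * n)) * exp (- c) ^ card U"
    proof (cases "real (card U) \<le> \<delta> * n")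
      case True
      have "?P (stuck U) \<le> 2 * z ^ card U"
        unfolding stuck_def z_def
        using prob_stuck_le[OF m n k d _ x, of ?B "1 - \<delta>"] prod_slices_ge[OF _ n, of ?B k _ \<delta>] True
        unfolding VB by auto
      moreover have "0 \<le> 2 * exp (- (c * \<delta> * n)) * exp (- c) ^ card U" by simp
      ultimately show ?thesis by linarith
    next
      case False
      have "\<beta> ^ (k - 1) * real n ^ (k - 1) \<le> real (\<Prod>i\<in>{..<k} - {j}. card (slice ?B i))" if "j < k" for j
      proof -
        have "\<beta> ^ (k - 1) * real n ^ (k - 1) = (\<Prod>i\<in>{..<k} - {j}. \<beta> * n)"
          using that by (simp add: power_mult_distrib)
        also have "\<dots> \<le> (\<Prod>i\<in>{..<k} - {j}. real (card (slice ?B i)))"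
          using U \<beta> by (intro prod_mono) (auto simp: I_def)
        finally show ?thesis by simp
      qed
      then have "?P (stuck U) \<le> 2 * ((1 / x) ^ (d - 1) * exp (- ((1 - x) * \<beta> ^ (k - 1) * m / n))) ^ card U"
        unfolding stuck_def using prob_stuck_le[OF m n k d _ x, of ?B "\<beta> ^ (k - 1)"]
        unfolding VB by auto
      also have "\<dots> \<le> 2 * exp (- (2 * c)) ^ card U"
        using large x by (intro mult_left_mono power_mono) auto
      also have "\<dots> = 2 * exp (- (c * card U)) * exp (- c) ^ card U"
        by (simp add: algebra_simps flip: exp_of_nat_mult exp_add)
      also have "\<dots> \<le> 2 * exp (- (c * \<delta> * n)) * exp (- c) ^ card U"
        using False c by (intro mult_right_mono mult_left_mono) (auto simp: mult.assoc intro: mult_left_mono)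
      finally show ?thesis using z0 by (smt (verit) zero_le_power)
    qed
  qed
  also have "\<dots> = 2 * (\<Sum>U\<in>I. z ^ card U) + 2 * exp (- (c * \<delta> * n)) * (\<Sum>U\<in>I. exp (- c) ^ card U)"
    by (simp add: sum.distrib sum_distrib_left)
  also have "(\<Sum>U\<in>I. z ^ card U) \<le> (\<Sum>U\<in>Pow ?V - {{}}. z ^ card U)"
    using z0 by (intro sum_mono2) (auto simp: I_def)
  also have "(\<Sum>U\<in>Pow ?V - {{}}. z ^ card U) = (\<Sum>U\<in>Pow ?V. z ^ card U) - 1"
    by (subst sum_diff1) auto
  also have "(\<Sum>U\<in>Pow ?V. z ^ card U) = (1 + z) ^ (k * n)"
    using sum_power_card_subsets[of ?V z] unfolding cV by simp
  also have "(1 + z) ^ (k * n) \<le> exp (real k * n * z)" by (rule exp_bound[OF z0])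
  also have "(\<Sum>U\<in>I. exp (- c) ^ card U) \<le> (\<Sum>U\<in>Pow ?V. exp (- c) ^ card U)"
    by (intro sum_mono2) (auto simp: I_def)
  also have "(\<Sum>U\<in>Pow ?V. exp (- c) ^ card U) = (1 + exp (- c)) ^ (k * n)"
    using sum_power_card_subsets[of ?V "exp (- c)"] unfolding cV by simp
  also have "(1 + exp (- c)) ^ (k * n) \<le> exp (real k * n * exp (- c))" by (rule exp_bound) simp
  finally have "?P {\<Omega>. \<not> expanding k n d \<beta> \<Omega>}
      \<le> 2 * (exp (real k * n * z) - 1) + 2 * exp (- (c * \<delta> * n)) * exp (real k * n * exp (- c))" by simp
  also have "2 * exp (- (c * \<delta> * n)) * exp (real k * n * exp (- c)) = 2 * exp (real k * n * exp (- c) - c * \<delta> * n)"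
    by (simp add: mult.assoc flip: exp_add)
  finally show ?thesis .
qed

section \<open>Asymptotics\<close>

definition sample_size :: "nat \<Rightarrow> nat \<Rightarrow> nat"
  where "sample_size d n = nat \<lceil>n * ln n + real d * n * ln (ln n)\<rceil>"

lemma ln_ge_1: "n \<ge> 3 \<Longrightarrow> ln (real n) \<ge> 1"
proof -
  assume "n \<ge> 3"
  then have "exp 1 \<le> real n" using exp_le by linarith
  then show ?thesis using \<open>n \<ge> 3\<close> by (subst ln_ge_iff) auto
qed

lemma sample_size_bounds:
  assumes "n \<ge> 3"
  shows "n * ln n + real d * n * ln (ln n) \<le> sample_size d n"
    and "sample_size d n \<le> n * ln n + real d * n * ln (ln n) + 1"
    and "n * ln n \<le> sample_size d n"
proof -
  have "ln (real n) \<ge> 1" by (rule ln_ge_1[OF assms])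
  then have *: "0 \<le> n * ln n" "0 \<le> real d * n * ln (ln n)" by simp_all
  then show 1: "n * ln n + real d * n * ln (ln n) \<le> sample_size d n"
    and "sample_size d n \<le> n * ln n + real d * n * ln (ln n) + 1"
    unfolding sample_size_def by linarith+
  show "n * ln n \<le> sample_size d n" using 1 * by linarith
qed

lemma sample_size_asymp:
  "(\<lambda>n. real (sample_size d n) - (real n * ln (real n) + real d * real n * ln (ln (real n))))
    \<in> o(\<lambda>n. real n * ln (ln (real n)))"
proof (rule landau_o.big_small_trans)
  show "(\<lambda>n. real (sample_size d n) - (real n * ln (real n) + real d * real n * ln (ln (real n)))) \<in> O(\<lambda>_. 1)"
  proof (rule bigoI[of _ 1])
    show "\<forall>\<^sub>F n in sequentially. norm (real (sample_size d n) - (real n * ln (real n) + real d * real n * ln (ln (real n)))) \<le> 1 * norm (1 :: real)"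
      using eventually_ge_at_top[of 3]
    proof eventually_elim
      case (elim n)
      show ?case using sample_size_bounds[OF elim, of d] by simp
    qed
  qed
  show "(\<lambda>n::nat. 1 :: real) \<in> o(\<lambda>n. real n * ln (ln (real n)))" by real_asymp
qed

lemma eventually_sample_size_square_le:
  assumes "k \<ge> 3"
  shows "\<forall>\<^sub>F n in sequentially. 2 * (sample_size d n)\<^sup>2 \<le> n ^ k"
proof -
  have "\<forall>\<^sub>F n::nat in at_top. 2 * (n * ln n + real d * n * ln (ln n) + 1)^2 \<le> real n^3"
    by real_asymp
  then show ?thesis using eventually_ge_at_top[of 3]
  proof eventually_elim
    case (elim n)
    have "real (2 * (sample_size d n)\<^sup>2) = 2 * (real (sample_size d n))\<^sup>2" by simp
    also have "\<dots> \<le> 2 * (n * ln n + real d * n * ln (ln n) + 1)^2"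
      using sample_size_bounds(2)[OF elim(2), of d] by (intro mult_left_mono power_mono) auto
    also have "\<dots> \<le> real n ^ 3" by (rule elim(1))
    also have "\<dots> \<le> real n ^ k" using elim(2) assms by (intro power_increasing) auto
    finally show ?case by (simp only: of_nat_le_iff flip: of_nat_power)
  qed
qed

text \<open>The number of agreement sets is at most \<open>exp (k * d * (k + 1) * n ln n)\<close>, which dictates the choice of
  the density.\<close>

lemma entropy_le:
  assumes n: "n \<ge> 3" and m: "n * ln n \<le> real m"
  shows "real ((n ^ k + 1) ^ (d * (k * n))) * (2 * exp (- (real k * d * (real k + 1) + 1)) ^ m) \<le> 2 * exp (- (n * ln n))"
proof -
  let ?a = "real k * d * (real k + 1)"
  have "n ^ k + 1 \<le> 2 * n ^ k" using n by simp
  also have "\<dots> \<le> n ^ (k + 1)" using n by simp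
  finally have "(n ^ k + 1) ^ (d * (k * n)) \<le> (n ^ (k + 1)) ^ (d * (k * n))" by (rule power_mono) simp
  then have "real ((n ^ k + 1) ^ (d * (k * n))) \<le> real ((n ^ (k + 1)) ^ (d * (k * n)))" by (rule of_nat_mono)
  also have "\<dots> = real n ^ ((k + 1) * (d * (k * n)))" by (simp only: of_nat_power power_mult)
  also have "\<dots> = exp (ln n) ^ ((k + 1) * (d * (k * n)))" using n by simp
  also have "\<dots> = exp (?a * (n * ln n))" by (simp add: algebra_simps flip: exp_of_nat_mult)
  finally have 1: "real ((n ^ k + 1) ^ (d * (k * n))) \<le> exp (?a * (n * ln n))" .
  have "exp (- (?a + 1)) ^ m = exp (- ((?a + 1) * m))" by (simp add: algebra_simps flip: exp_of_nat_mult)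
  also have "\<dots> \<le> exp (- ((?a + 1) * (n * ln n)))"
  proof -
    have "(?a + 1) * (n * ln n) \<le> (?a + 1) * m" using m by (intro mult_left_mono) auto
    then show ?thesis by (simp only: exp_le_cancel_iff neg_le_iff_le)
  qed
  finally have 2: "exp (- (?a + 1)) ^ m \<le> exp (- ((?a + 1) * (n * ln n)))" .
  have "real ((n ^ k + 1) ^ (d * (k * n))) * (2 * exp (- (?a + 1)) ^ m)
      \<le> exp (?a * (n * ln n)) * (2 * exp (- ((?a + 1) * (n * ln n))))"
    using 1 2 by (intro mult_mono) auto
  also have "\<dots> = 2 * exp (- (n * ln n))" by (simp add: algebra_simps flip: exp_add)
  finally show ?thesis .
qed

text \<open>With \<open>L = ln n\<close> choose \<open>x = \<delta> = 1 / L\<close> and \<open>c\<close> proportional to \<open>L\<close>. A single vertex is then stuck with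
  probability at most \<open>L ^ (d - 1) * exp (- ((1 - 1 / L)\<^sup>2 * m / n))\<close>, and \<open>m / n \<ge> L + d ln L\<close> makes this
  \<open>O (1 / (n * L))\<close>: the summand \<open>d ln L\<close> cancels the \<open>d - 1\<close> factors \<open>L\<close> and leaves one more to spare.\<close>

lemma prob_not_expanding_tendsto_0:
  assumes d: "d \<ge> 1" and k: "k \<ge> 3" and \<beta>: "\<beta> > 0"
  shows "(\<lambda>n. measure_pmf.prob (random_positions k n (sample_size d n)) {\<Omega>. \<not> expanding k n d \<beta> \<Omega>}) \<longlonglongrightarrow> 0"
proof -
  define D where "D = real (d - 1)"
  define \<gamma> where "\<gamma> = \<beta> ^ (k - 1)"
  have \<gamma>: "\<gamma> > 0" using \<beta> by (simp add: \<gamma>_def)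
  have dD: "real d = D + 1" using d by (simp add: D_def)
  define E where "E n = ln n + D * ln (ln n) - (1 - 1 / ln n)^2 * (ln n + (D + 1) * ln (ln n))" for n :: nat
  define g where "g n = 2 * (exp (k * exp (E n)) - 1) + 2 * exp (n * (k * exp (- (\<gamma> * ln n / 8)) - \<gamma> / 8))" for n :: nat
  have "filterlim E at_bot at_top" unfolding E_def by real_asymp
  then have "(\<lambda>n. exp (E n)) \<longlonglongrightarrow> 0" by (rule filterlim_compose[OF exp_at_bot])
  then have "(\<lambda>n. 2 * (exp (k * exp (E n)) - 1)) \<longlonglongrightarrow> 2 * (exp (real k * 0) - 1)" by (intro tendsto_intros)
  moreover have "(\<lambda>n::nat. exp (n * (k * exp (- (\<gamma> * ln n / 8)) - \<gamma> / 8))) \<longlonglongrightarrow> 0"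
    using \<gamma> by real_asymp
  ultimately have "g \<longlonglongrightarrow> 2 * (exp (real k * 0) - 1) + 2 * 0"
    unfolding g_def by (rule tendsto_add[OF _ tendsto_mult_left])
  then have g: "g \<longlonglongrightarrow> 0" by simp
  have "\<forall>\<^sub>F n::nat in at_top. D * ln (ln n) - (1 - 1 / ln n) * \<gamma> * ln n \<le> - (\<gamma> * ln n / 4)"
    using \<gamma> by real_asymp
  then have "\<forall>\<^sub>F n in sequentially.
      measure_pmf.prob (random_positions k n (sample_size d n)) {\<Omega>. \<not> expanding k n d \<beta> \<Omega>} \<le> g n"
    using eventually_ge_at_top[of 3] eventually_sample_size_square_le[OF k, of d]
  proof eventually_elim
    case (elim n)
    define L where "L = ln (real n)"
    define m where "m = sample_size d n"
    have L: "L \<ge> 1" unfolding L_def by (rule ln_ge_1[OF elim(2)])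
    have n: "n > 0" using elim(2) by simp
    have pow: "(1 / (1 / L)) ^ (d - 1) = exp (D * ln L)"
      using L by (simp add: D_def exp_of_nat_mult)
    have mn: "L \<le> m / n" "L + (D + 1) * ln L \<le> m / n"
    proof -
      show "L \<le> m / n" using sample_size_bounds(3)[OF elim(2), of d] n
        by (simp add: m_def L_def field_simps)
      have "n * (L + (D + 1) * ln L) \<le> m" using sample_size_bounds(1)[OF elim(2), of d]
        by (simp add: m_def L_def dD algebra_simps)
      then show "L + (D + 1) * ln L \<le> m / n" using n by (simp add: field_simps)
    qed
    define c where "c = \<gamma> * L / 8"
    have "(1 / (1 / L)) ^ (d - 1) * exp (- ((1 - 1 / L) * \<beta> ^ (k - 1) * m / n))
        = exp (D * ln L - (1 - 1 / L) * \<gamma> * (m / n))"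
      unfolding pow by (simp add: \<gamma>_def flip: exp_add)
    also have "\<dots> \<le> exp (D * ln L - (1 - 1 / L) * \<gamma> * L)"
    proof -
      have "(1 - 1 / L) * \<gamma> * L \<le> (1 - 1 / L) * \<gamma> * (m / n)"
        using mn(1) L \<gamma> by (intro mult_left_mono mult_nonneg_nonneg) auto
      then show ?thesis by simp
    qed
    also have "\<dots> \<le> exp (- (2 * c))"
      using elim(1) by (simp add: c_def L_def)
    finally have large: "(1 / (1 / L)) ^ (d - 1) * exp (- ((1 - 1 / L) * \<beta> ^ (k - 1) * m / n)) \<le> exp (- (2 * c))" .
    let ?z = "(1 / (1 / L)) ^ (d - 1) * exp (- ((1 - 1 / L) * (1 - 1 / L) * m / n))"
    have "n * ?z = exp L * (exp (D * ln L) * exp (- ((1 - 1 / L) * (1 - 1 / L) * m / n)))"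
      unfolding pow using n by (simp add: L_def)
    also have "\<dots> = exp (L + D * ln L - (1 - 1 / L)\<^sup>2 * (m / n))"
      by (simp add: power2_eq_square flip: exp_add)
    also have "\<dots> \<le> exp (E n)"
    proof -
      have "(1 - 1 / L)\<^sup>2 * (L + (D + 1) * ln L) \<le> (1 - 1 / L)\<^sup>2 * (m / n)"
        using mn(2) by (intro mult_left_mono) auto
      then show ?thesis by (simp add: E_def L_def)
    qed
    finally have z: "real k * n * ?z \<le> k * exp (E n)" by (simp only: mult.assoc) (rule mult_left_mono, auto)
    have "measure_pmf.prob (random_positions k n m) {\<Omega>. \<not> expanding k n d \<beta> \<Omega>}
        \<le> 2 * (exp (real k * n * ?z) - 1) + 2 * exp (real k * n * exp (- c) - c * (1 / L) * n)"
      using prob_not_expanding_le[OF _ n _ d _ _ \<beta> _ large, of "1 / L"] elim(3) k L \<gamma>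
      by (simp add: m_def c_def)
    also have "real k * n * exp (- c) - c * (1 / L) * n = n * (k * exp (- (\<gamma> * L / 8)) - \<gamma> / 8)"
      using L by (simp add: c_def algebra_simps)
    also have "2 * (exp (real k * n * ?z) - 1) \<le> 2 * (exp (k * exp (E n)) - 1)"
      using z by simp
    finally show ?case by (simp add: g_def m_def L_def)
  qed
  then show ?thesis
    by (intro tendsto_sandwich[OF _ _ tendsto_const g]) auto
qed

text \<open>A generic tensor is recovered whenever \<open>\<Omega>\<close> is expanding and every tensor of rank at most \<open>d\<close> that agrees
  with it on \<open>\<Omega>\<close> agrees with it densely; both fail with a probability tending to \<open>0\<close>.\<close>

theorem recovery_probability_tendsto_1:
  fixes T :: "nat \<Rightarrow> (nat \<Rightarrow> nat) \<Rightarrow> 'a::field_char_0"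
  assumes d: "d \<ge> 1" and k: "k \<ge> 3" and gen: "\<forall>\<^sub>F n in sequentially. generic_tensor k n d (T n)"
  shows "(\<lambda>n. measure_pmf.prob (random_positions k n (sample_size d n))
    {\<Omega>. uniquely_determines k n d (T n) \<Omega>}) \<longlonglongrightarrow> 1"
proof -
  \<comment> \<open>Small enough for \<open>2 * \<epsilon> ^ m\<close> to beat the number of agreement sets.\<close>
  define \<epsilon> where "\<epsilon> = exp (- (real k * d * (real k + 1) + 1))"
  have \<epsilon>: "\<epsilon> > 0" by (simp add: \<epsilon>_def)
  have "k \<ge> 2" using k by simp
  from agreement_propagates[OF this \<epsilon>, of d, where 'a = 'a] obtain \<beta> n0 where \<beta>: "\<beta> > 0"
    and propagate: "\<forall>n\<ge>n0. \<forall>(x :: nat \<Rightarrow> nat \<Rightarrow> nat \<Rightarrow> 'a) y \<Omega>.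
      alg_independent_rat ({..<d} \<times> {..<k} \<times> {..<n}) (\<lambda>(i, j, l). x i j l) \<longrightarrow>
      expanding k n d \<beta> \<Omega> \<longrightarrow>
      (\<forall>p\<in>\<Omega>. cp_tensor k n d y p = cp_tensor k n d x p) \<longrightarrow>
      \<epsilon> * real n ^ k \<le> card {p \<in> positions k n. cp_tensor k n d y p = cp_tensor k n d x p} \<longrightarrow>
      cp_tensor k n d y = cp_tensor k n d x"
    by blast
  let ?P = "\<lambda>n. measure_pmf.prob (random_positions k n (sample_size d n))"
  define bad where "bad n = {\<Omega>. \<not> expanding k n d \<beta> \<Omega>}" for n
  have lower: "\<forall>\<^sub>F n in sequentially. 1 - 2 * exp (- (n * ln n)) - ?P n (bad n)
      \<le> ?P n {\<Omega>. uniquely_determines k n d (T n) \<Omega>}"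
    using gen eventually_ge_at_top[of "max 3 n0"] eventually_sample_size_square_le[OF k, of d]
  proof eventually_elim
    case (elim n)
    let ?m = "sample_size d n" and ?UD = "{\<Omega>. uniquely_determines k n d (T n) \<Omega>}"
    let ?sparse = "{\<Omega>. \<Omega> \<subseteq> positions k n \<and> (\<exists>y. (\<forall>p\<in>\<Omega>. cp_tensor k n d y p = T n p) \<and>
        card {p \<in> positions k n. cp_tensor k n d y p = T n p} < \<epsilon> * real n ^ k)}"
    have n: "n \<ge> 3" "n \<ge> n0" using elim(2) by auto
    obtain x where Tx: "T n = cp_tensor k n d x"
      and ind: "alg_independent_rat ({..<d} \<times> {..<k} \<times> {..<n}) (\<lambda>(i, j, l). x i j l)"
      using elim(1) unfolding generic_tensor_def by blast
    have "\<Omega> \<in> ?UD" if \<Omega>: "\<Omega> \<subseteq> positions k n" "\<Omega> \<notin> ?sparse" "\<Omega> \<notin> bad n" for \<Omega>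
    proof -
      have "S = T n" if S: "S \<in> tensors k n" "cp_rank k n S \<le> d" "\<forall>p\<in>\<Omega>. S p = T n p" for S
      proof -
        obtain y where y: "S = cp_tensor k n d y"
          using cp_rank_le_imp_decomposition[OF _ S(1,2)] k by auto
        have agree: "\<forall>p\<in>\<Omega>. cp_tensor k n d y p = cp_tensor k n d x p" using S(3) by (simp add: y Tx)
        moreover have "\<epsilon> * real n ^ k \<le> card {p \<in> positions k n. cp_tensor k n d y p = cp_tensor k n d x p}"
        proof (rule ccontr)
          assume "\<not> ?thesis"
          then have "\<Omega> \<in> ?sparse" using \<Omega>(1) agree unfolding Tx by (auto simp: not_le)
          with \<Omega>(2) show False by blast
        qed
        moreover have "expanding k n d \<beta> \<Omega>" using \<Omega>(3) by (simp add: bad_def)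
        ultimately show ?thesis using propagate n(2) ind unfolding y Tx by blast
      qed
      then show ?thesis by (simp add: uniquely_determines_def)
    qed
    moreover have "\<Omega> \<subseteq> positions k n" if "\<Omega> \<in> set_pmf (random_positions k n ?m)" for \<Omega>
    proof -
      let ?F = "{\<Omega>. \<Omega> \<subseteq> positions k n \<and> card \<Omega> = ?m}"
      have "?m \<le> ?m\<^sup>2" by (simp add: power2_eq_square)
      then have "?m \<le> card (positions k n)" using elim(3) unfolding card_positions by linarith
      then have "?F \<noteq> {}" by (metis (mono_tags, lifting) empty_iff mem_Collect_eq obtain_subset_with_card_n)
      moreover have "finite ?F" by (rule finite_subset[of _ "Pow (positions k n)"]) auto
      ultimately show ?thesis using that by (simp add: random_positions_def set_pmf_of_set)
    qed
    ultimately have cover: "set_pmf (random_positions k n ?m) \<subseteq> (?sparse \<union> bad n) \<union> ?UD" by blast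
    have "1 = ?P n (set_pmf (random_positions k n ?m))"
      using measure_Int_set_pmf[of "random_positions k n ?m" UNIV] by simp
    also have "\<dots> \<le> ?P n ((?sparse \<union> bad n) \<union> ?UD)"
      using cover by (rule measure_pmf.finite_measure_mono) simp
    also have "\<dots> \<le> ?P n (?sparse \<union> bad n) + ?P n ?UD"
      by (rule measure_Un_le) auto
    also have "?P n (?sparse \<union> bad n) \<le> ?P n ?sparse + ?P n (bad n)"
      by (rule measure_Un_le) auto
    also have "?P n ?sparse \<le> 2 * exp (- (n * ln n))"
    proof -
      have "?P n ?sparse \<le> real ((n ^ k + 1) ^ (d * (k * n))) * (2 * \<epsilon> ^ ?m)"
        using n by (intro prob_sparse_agreement_le elim(3) \<epsilon>) auto
      also have "\<dots> \<le> 2 * exp (- (n * ln n))"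
        unfolding \<epsilon>_def by (rule entropy_le[OF n(1) sample_size_bounds(3)[OF n(1)]])
      finally show ?thesis .
    qed
    finally show ?case by linarith
  qed
  have "(\<lambda>n::nat. exp (- (n * ln n))) \<longlonglongrightarrow> (0::real)" by real_asymp
  moreover have "(\<lambda>n. ?P n (bad n)) \<longlonglongrightarrow> 0"
    unfolding bad_def by (rule prob_not_expanding_tendsto_0[OF d k \<beta>])
  ultimately have "(\<lambda>n::nat. 1 - 2 * exp (- (n * ln n)) - ?P n (bad n)) \<longlonglongrightarrow> 1 - 2 * 0 - 0"
    by (intro tendsto_intros)
  then have "(\<lambda>n::nat. 1 - 2 * exp (- (n * ln n)) - ?P n (bad n)) \<longlonglongrightarrow> 1" by simp
  from tendsto_sandwich[OF lower _ this tendsto_const] show ?thesis by simp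
qed

theorem theorem1p1:
  fixes d k :: nat
  assumes "d \<ge> 1" and "k \<ge> 3"
  shows
    "(\<exists>m :: nat \<Rightarrow> nat.
        (\<lambda>n. real (m n) - (real n * ln (real n) + real d * real n * ln (ln (real n))))
          \<in> o(\<lambda>n. real n * ln (ln (real n))) \<and>
        (\<forall>T :: nat \<Rightarrow> (nat \<Rightarrow> nat) \<Rightarrow> real.
          (\<forall>\<^sub>F n in sequentially. generic_tensor k n d (T n)) \<longrightarrow>
          (\<lambda>n. measure_pmf.prob (random_positions k n (m n)) {\<Omega>. uniquely_determines k n d (T n) \<Omega>})
            \<longlonglongrightarrow> 1)) \<and>
     (\<exists>m :: nat \<Rightarrow> nat.
        (\<lambda>n. real (m n) - (real n * ln (real n) + real d * real n * ln (ln (real n))))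
          \<in> o(\<lambda>n. real n * ln (ln (real n))) \<and>
        (\<forall>T :: nat \<Rightarrow> (nat \<Rightarrow> nat) \<Rightarrow> complex.
          (\<forall>\<^sub>F n in sequentially. generic_tensor k n d (T n)) \<longrightarrow>
          (\<lambda>n. measure_pmf.prob (random_positions k n (m n)) {\<Omega>. uniquely_determines k n d (T n) \<Omega>})
            \<longlonglongrightarrow> 1))"
  by (intro conjI exI[of _ "sample_size d"] allI impI sample_size_asymp
      recovery_probability_tendsto_1[OF assms])

end
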